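(* Let $\varepsilon=\frac{1}{2}\log\big((2/3)\,2^{2/3}\big)=0.02831\ldots$ (natural logarithm). If $H$ is a finite abelian group generated by elements of order at most $m$, then every tricolored sum-free set in $H$ has cardinality at most $3\cdot\lvert H\rvert^{1-\frac{\varepsilon}{m}}$.
   Context: A tricolored sum-free set in an abelian group $H$ (written additively) is a set $M\subseteq S\times T\times U$, where $S,T,U\subseteq H$, such that $M$ is a 3-dimensional perfect matching on $S\times T\times U$ (each of the three coordinate projections $M\to S$, $M\to T$, $M\to U$ is a bijection), $s+t+u=0$ for all $(s,t,u)\in M$, and $s+t+u\neq 0$ for all $(s,t,u)\in (S\times T\times U)\setminus M$. Its cardinality is $\lvert M\rvert$. *)

theory Defs
  imports Complex_Main "HOL-Algebra.Algebra"
begin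

definition perfect_matching3 ::
    "'a set \<Rightarrow> 'b set \<Rightarrow> 'c set \<Rightarrow> ('a \<times> 'b \<times> 'c) set \<Rightarrow> bool" where
  "perfect_matching3 S T U M \<longleftrightarrow>
     M \<subseteq> S \<times> T \<times> U \<and>
     bij_betw (\<lambda>(s, t, u). s) M S \<and>
     bij_betw (\<lambda>(s, t, u). t) M T \<and>
     bij_betw (\<lambda>(s, t, u). u) M U"

(* Abelian groups are HOL-Algebra's commutative groups, which are written multiplicatively:
   s + t + u = 0 becomes the product of s, t, u being the unit. *)
definition tricolored_sum_free :: "('a, 'b) monoid_scheme \<Rightarrow> ('a \<times> 'a \<times> 'a) set \<Rightarrow> bool" where
  "tricolored_sum_free H M \<longleftrightarrow>
     (\<exists>S T U. S \<subseteq> carrier H \<and> T \<subseteq> carrier H \<and> U \<subseteq> carrier H \<and>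
        perfect_matching3 S T U M \<and>
        (\<forall>(s, t, u) \<in> M. s \<otimes>\<^bsub>H\<^esub> t \<otimes>\<^bsub>H\<^esub> u = \<one>\<^bsub>H\<^esub>) \<and>
        (\<forall>(s, t, u) \<in> (S \<times> T \<times> U) - M. s \<otimes>\<^bsub>H\<^esub> t \<otimes>\<^bsub>H\<^esub> u \<noteq> \<one>\<^bsub>H\<^esub>))"

definition eps :: real where
  "eps = 1 / 2 * ln (2 / 3 * 2 powr (2 / 3))"

end

theory Submission
  imports Defs "HOL-Analysis.Convex"
begin

text \<open>Split \<open>H\<close> into cyclic groups of prime power orders \<open>q i \<le> m\<close>. For a prime \<open>p\<close>, the
  indicator of \<open>s + t + u = 0\<close> is, modulo \<open>p\<close>, a polynomial of degree \<open>q i - 1\<close> in each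
  coordinate \<open>i\<close> whose \<open>q i\<close> is a power of \<open>p\<close>. By Tao's slice rank method a tricolored
  sum-free set then has at most three times as many elements as there are exponent vectors \<open>e\<close>
  for which the sum of \<open>e i / (q i - 1)\<close> over these \<open>n\<close> coordinates is at most \<open>n / 3\<close>.
  Markov's inequality for \<open>2 powr - (\<Sum>i. e i / (q i - 1))\<close> and the chord bound for the convex
  function \<open>2 powr - t\<close> on the unit interval estimate their number by \<open>|H| * exp (- 2 * eps * n)\<close>. If
  \<open>p\<close> is chosen with \<open>n\<close> maximal, then \<open>|H| \<le> lcm(1,\<dots>,m) ^ n\<close>, and Chebyshev's bound
  \<open>lcm(1,\<dots>,m) \<le> 4 ^ m\<close> yields \<open>ln |H| \<le> 2 * m * n\<close>.\<close>

section \<open>Slice rank modulo a prime\<close>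

text \<open>Counting replaces the nontrivial kernel of a linear map with more unknowns than
  equations: \<open>p ^ card S\<close> coefficient vectors have at most \<open>p ^ card C\<close>
  value vectors modulo \<open>p\<close>, so two collide, and their difference is
  \<open>k\<close>.\<close>

lemma pigeonhole_congruence:
  fixes \<chi> :: "'c \<Rightarrow> 'x \<Rightarrow> int" and p :: nat
  assumes "finite S" "finite C" "card C < card S" "1 < p"
  obtains k where "\<exists>x\<in>S. \<not> int p dvd k x"
    and "\<And>c. c \<in> C \<Longrightarrow> int p dvd (\<Sum>x\<in>S. k x * \<chi> c x)"
proof -
  let ?E = "S \<rightarrow>\<^sub>E {0..<int p}" and ?V = "C \<rightarrow>\<^sub>E {0..<int p}"
  define \<Phi> where "\<Phi> f = (\<lambda>c\<in>C. (\<Sum>x\<in>S. f x * \<chi> c x) mod int p)" for f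
  have "\<Phi> ` ?E \<subseteq> ?V" using assms(4) by (auto simp: \<Phi>_def)
  moreover have "finite ?V" using assms by (intro finite_PiE) auto
  moreover have "card ?V < card ?E"
    using assms by (simp add: card_PiE power_strict_increasing)
  ultimately have "card (\<Phi> ` ?E) < card ?E" by (meson card_mono le_less_trans)
  then have "\<not> inj_on \<Phi> ?E" using card_image by (metis less_irrefl)
  then obtain f g where fg: "f \<in> ?E" "g \<in> ?E" "\<Phi> f = \<Phi> g" "f \<noteq> g" by (auto simp: inj_on_def)
  then obtain x where x: "x \<in> S" "f x \<noteq> g x" using PiE_ext[of f S _ g] by blast
  show thesis
  proof (rule that[of "\<lambda>x. f x - g x"])
    have "f x \<in> {0..<int p}" "g x \<in> {0..<int p}" using fg x by (auto simp: PiE_def Pi_def)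
    then have "\<not> int p dvd f x - g x" using x(2) by (auto simp flip: mod_eq_dvd_iff)
    then show "\<exists>x\<in>S. \<not> int p dvd f x - g x" using x(1) by blast
  next
    fix c assume "c \<in> C"
    then have "(\<Sum>x\<in>S. f x * \<chi> c x) mod int p = (\<Sum>x\<in>S. g x * \<chi> c x) mod int p"
      using fun_cong[OF fg(3), of c] by (simp add: \<Phi>_def)
    then show "int p dvd (\<Sum>x\<in>S. (f x - g x) * \<chi> c x)"
      by (simp add: mod_eq_dvd_iff left_diff_distrib sum_subtractf)
  qed
qed

text \<open>A solution of maximal support works: if its zero set modulo \<open>p\<close> had more
  than \<open>card C\<close> points, a further nontrivial solution would live there, and adding it
  would enlarge the support.\<close>

lemma large_support_congruence:
  fixes \<chi> :: "'c \<Rightarrow> 'x \<Rightarrow> int" and p :: nat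
  assumes fin: "finite Z" "finite C" and p: "1 < p"
  obtains h where "\<And>c. c \<in> C \<Longrightarrow> int p dvd (\<Sum>x\<in>Z. h x * \<chi> c x)"
    and "card Z \<le> card C + card {x \<in> Z. \<not> int p dvd h x}"
proof -
  define W where "W = {h. \<forall>c\<in>C. int p dvd (\<Sum>x\<in>Z. h x * \<chi> c x)}"
  define supp where "supp h = {x \<in> Z. \<not> int p dvd h x}" for h :: "'x \<Rightarrow> int"
  have "(\<lambda>_. 0) \<in> W" by (simp add: W_def)
  moreover have "\<forall>h. h \<in> W \<longrightarrow> card (supp h) < Suc (card Z)"
    using fin by (auto simp: supp_def intro!: card_mono le_imp_less_Suc)
  ultimately obtain h where h: "h \<in> W" "\<And>h'. h' \<in> W \<Longrightarrow> card (supp h') \<le> card (supp h)"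
    using ex_has_greatest_nat[of "\<lambda>h. h \<in> W" _ "\<lambda>h. card (supp h)"] by blast
  have "card Z \<le> card C + card (supp h)"
  proof (rule ccontr)
    assume *: "\<not> ?thesis"
    have sub: "supp h \<subseteq> Z" by (auto simp: supp_def)
    let ?Y = "Z - supp h"
    have "card C < card ?Y" using * fin sub by (subst card_Diff_subset) (auto intro: finite_subset)
    then obtain k where k: "\<exists>x\<in>?Y. \<not> int p dvd k x"
      and k0: "\<And>c. c \<in> C \<Longrightarrow> int p dvd (\<Sum>x\<in>?Y. k x * \<chi> c x)"
      using pigeonhole_congruence[of ?Y C p \<chi>] fin p by auto
    define h' where "h' x = h x + (if x \<in> ?Y then k x else 0)" for x
    have "(\<Sum>x\<in>Z. h' x * \<chi> c x) = (\<Sum>x\<in>Z. h x * \<chi> c x) + (\<Sum>x\<in>?Y. k x * \<chi> c x)" for c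
    proof -
      have "(\<Sum>x\<in>?Y. k x * \<chi> c x) = (\<Sum>x\<in>Z. (if x \<in> ?Y then k x else 0) * \<chi> c x)"
        using fin(1) by (intro sum.mono_neutral_cong_left) auto
      then show ?thesis by (simp add: h'_def distrib_right sum.distrib)
    qed
    then have "h' \<in> W" using h(1) k0 by (auto simp: W_def)
    obtain x where x: "x \<in> ?Y" "\<not> int p dvd k x" using k by blast
    then have "int p dvd h x" by (auto simp: supp_def)
    then have "x \<in> supp h' - supp h" using x by (auto simp: supp_def h'_def dvd_add_right_iff)
    moreover have "supp h \<subseteq> supp h'" by (auto simp: supp_def h'_def)
    ultimately have "supp h \<subset> supp h'" by blast
    then have "card (supp h) < card (supp h')"
      by (intro psubset_card_mono) (auto simp: supp_def fin)
    then show False using h(2)[OF \<open>h' \<in> W\<close>] by simp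
  qed
  then show thesis using that h(1) unfolding W_def supp_def by blast
qed

text \<open>Tao's argument: a combination of the \<open>z\<close>-slices that kills all \<open>\<chi> c\<close> is a diagonal matrix
  with few zeros on its diagonal, but of rank at most \<open>card A + card B\<close>. Counting replaces linear
  algebra over the prime field, which is not available as a type because \<open>p\<close> is a variable.\<close>

lemma slice_rank_diagonal:
  fixes F :: "'x \<Rightarrow> 'x \<Rightarrow> 'x \<Rightarrow> int" and p :: nat
  assumes Z: "finite Z" and fin: "finite A" "finite B" "finite C" and p: "Factorial_Ring.prime p"
    and F: "\<And>x y z. \<lbrakk>x \<in> Z; y \<in> Z; z \<in> Z\<rbrakk> \<Longrightarrow> F x y z =
      (\<Sum>a\<in>A. \<phi> a x * \<phi>' a y z) + (\<Sum>b\<in>B. \<psi> b y * \<psi>' b x z) + (\<Sum>c\<in>C. \<chi> c z * \<chi>' c x y)"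
    and diag: "\<And>x y z. \<lbrakk>x \<in> Z; y \<in> Z; z \<in> Z\<rbrakk> \<Longrightarrow> int p dvd F x y z \<longleftrightarrow> \<not> (x = y \<and> y = z)"
  shows "card Z \<le> card A + card B + card C"
proof -
  have p1: "1 < p" using p by (rule prime_gt_1_nat)
  have ip: "Factorial_Ring.prime (int p)" using p by simp
  obtain h where h0: "\<And>c. c \<in> C \<Longrightarrow> int p dvd (\<Sum>z\<in>Z. h z * \<chi> c z)"
    and hZ: "card Z \<le> card C + card {x \<in> Z. \<not> int p dvd h x}"
    using large_support_congruence[OF Z fin(3) p1] by blast
  define S where "S = {x \<in> Z. \<not> int p dvd h x}"
  have S: "S \<subseteq> Z" "finite S" using Z by (auto simp: S_def)
  \<comment> \<open>Contracting \<open>F\<close> with \<open>h\<close> over \<open>z\<close> removes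
    the \<open>\<chi>\<close>-slices modulo \<open>p\<close> and leaves a matrix in \<open>x\<close>
    and \<open>y\<close>. Its columns are combinations of the functions \<open>\<omega>\<close>, one
    for each index in \<open>A\<close> or \<open>B\<close>.\<close>
  define \<omega> where "\<omega> ab x = (case ab of Inl a \<Rightarrow> \<phi> a x | Inr b \<Rightarrow> (\<Sum>z\<in>Z. h z * \<psi>' b x z))" for ab x
  have "card S \<le> card (Sum_Type.Plus A B)"
  proof (rule ccontr)
    assume "\<not> ?thesis"
    then obtain k where k: "\<exists>x\<in>S. \<not> int p dvd k x"
      and k0: "\<And>c. c \<in> Sum_Type.Plus A B \<Longrightarrow> int p dvd (\<Sum>x\<in>S. k x * \<omega> c x)"
      using pigeonhole_congruence[of S "Sum_Type.Plus A B" p \<omega>] S fin p1 by auto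
    from k obtain y where y: "y \<in> S" "\<not> int p dvd k y" by blast
    have kA: "int p dvd (\<Sum>x\<in>S. k x * \<phi> a x)" if "a \<in> A" for a
      using k0[OF InlI[OF that]] by (simp add: \<omega>_def)
    have kB: "int p dvd (\<Sum>x\<in>S. k x * (\<Sum>z\<in>Z. h z * \<psi>' b x z))" if "b \<in> B" for b
      using k0[OF InrI[OF that]] by (simp add: \<omega>_def)
    \<comment> \<open>This is entry \<open>y\<close> of the combination of rows with coefficients
      \<open>k\<close>. The slice expansion makes it divisible by \<open>p\<close>, while
      diagonality reduces it to \<open>k y * h y * F y y y\<close>, which is not.\<close>
    let ?D = "\<Sum>x\<in>S. \<Sum>z\<in>Z. k x * h z * F x y z"
    have "?D = (\<Sum>x\<in>S. \<Sum>z\<in>Z. k x * h z * ((\<Sum>a\<in>A. \<phi> a x * \<phi>' a y z)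
        + (\<Sum>b\<in>B. \<psi> b y * \<psi>' b x z) + (\<Sum>c\<in>C. \<chi> c z * \<chi>' c x y)))"
      using y S by (intro sum.cong refl arg_cong2[of _ _ _ _ "(*)"] F) auto
    also have "\<dots> = (\<Sum>x\<in>S. \<Sum>z\<in>Z. \<Sum>a\<in>A. k x * h z * (\<phi> a x * \<phi>' a y z))
       + (\<Sum>x\<in>S. \<Sum>z\<in>Z. \<Sum>b\<in>B. k x * h z * (\<psi> b y * \<psi>' b x z))
       + (\<Sum>x\<in>S. \<Sum>z\<in>Z. \<Sum>c\<in>C. k x * h z * (\<chi> c z * \<chi>' c x y))"
      by (simp add: distrib_left sum.distrib sum_distrib_left)
    also have "(\<Sum>x\<in>S. \<Sum>z\<in>Z. \<Sum>a\<in>A. k x * h z * (\<phi> a x * \<phi>' a y z))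
        = (\<Sum>z\<in>Z. \<Sum>a\<in>A. h z * \<phi>' a y z * (\<Sum>x\<in>S. k x * \<phi> a x))"
      by (subst sum.swap, rule sum.cong[OF refl], subst sum.swap) (simp add: sum_distrib_left mult_ac)
    also have "(\<Sum>x\<in>S. \<Sum>z\<in>Z. \<Sum>b\<in>B. k x * h z * (\<psi> b y * \<psi>' b x z))
        = (\<Sum>b\<in>B. \<psi> b y * (\<Sum>x\<in>S. k x * (\<Sum>z\<in>Z. h z * \<psi>' b x z)))"
      by (simp add: sum_distrib_left mult_ac sum.swap[of _ Z B] sum.swap[of _ S B])
    also have "(\<Sum>x\<in>S. \<Sum>z\<in>Z. \<Sum>c\<in>C. k x * h z * (\<chi> c z * \<chi>' c x y))
        = (\<Sum>x\<in>S. \<Sum>c\<in>C. k x * \<chi>' c x y * (\<Sum>z\<in>Z. h z * \<chi> c z))"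
      by (rule sum.cong[OF refl], subst sum.swap) (simp add: sum_distrib_left mult_ac)
    finally have "int p dvd ?D"
    proof (elim ssubst, intro dvd_add)
      show "int p dvd (\<Sum>z\<in>Z. \<Sum>a\<in>A. h z * \<phi>' a y z * (\<Sum>x\<in>S. k x * \<phi> a x))"
        by (rule dvd_sum, rule dvd_sum, rule dvd_mult, erule kA)
      show "int p dvd (\<Sum>b\<in>B. \<psi> b y * (\<Sum>x\<in>S. k x * (\<Sum>z\<in>Z. h z * \<psi>' b x z)))"
        by (rule dvd_sum, rule dvd_mult, erule kB)
      show "int p dvd (\<Sum>x\<in>S. \<Sum>c\<in>C. k x * \<chi>' c x y * (\<Sum>z\<in>Z. h z * \<chi> c z))"
        by (rule dvd_sum, rule dvd_sum, rule dvd_mult, erule h0)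
    qed
    moreover have "?D = k y * h y * F y y y
        + (\<Sum>z\<in>Z - {y}. k y * h z * F y y z) + (\<Sum>x\<in>S - {y}. \<Sum>z\<in>Z. k x * h z * F x y z)"
    proof -
      have "y \<in> Z" using y S by blast
      then show ?thesis using y S Z by (simp add: sum.remove[of S y] sum.remove[of Z y "\<lambda>z. k y * h z * F y y z"])
    qed
    moreover have "int p dvd (\<Sum>z\<in>Z - {y}. k y * h z * F y y z)"
      using y S diag by (intro dvd_sum dvd_mult) auto
    moreover have "int p dvd (\<Sum>x\<in>S - {y}. \<Sum>z\<in>Z. k x * h z * F x y z)"
      using y subsetD[OF S(1)] diag by (intro dvd_sum dvd_mult) auto
    ultimately have "int p dvd k y * h y * F y y y" by (simp add: dvd_add_left_iff)
    then have "int p dvd F y y y" using y ip by (auto simp: S_def prime_dvd_mult_iff)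
    then show False using y S diag by auto
  qed
  then show ?thesis using hZ fin by (simp add: S_def card_Plus)
qed

text \<open>Each term goes to the first of its three indices that lies in \<open>L\<close>. Grouping
  the terms by that index and pulling out its factor leaves at most \<open>card L\<close> slices in
  each of the three directions.\<close>

lemma slice_rank_bound:
  fixes F :: "'x \<Rightarrow> 'x \<Rightarrow> 'x \<Rightarrow> int" and p :: nat
  assumes Z: "finite Z" and fin: "finite T" "finite L" and p: "Factorial_Ring.prime p"
    and F: "\<And>x y z. \<lbrakk>x \<in> Z; y \<in> Z; z \<in> Z\<rbrakk> \<Longrightarrow>
      F x y z = (\<Sum>\<tau>\<in>T. \<phi> (f \<tau>) x * \<psi> (g \<tau>) y * \<chi> (h \<tau>) z)"
    and L: "\<And>\<tau>. \<tau> \<in> T \<Longrightarrow> f \<tau> \<in> L \<or> g \<tau> \<in> L \<or> h \<tau> \<in> L"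
    and diag: "\<And>x y z. \<lbrakk>x \<in> Z; y \<in> Z; z \<in> Z\<rbrakk> \<Longrightarrow> int p dvd F x y z \<longleftrightarrow> \<not> (x = y \<and> y = z)"
  shows "card Z \<le> 3 * card L"
proof -
  define T1 where "T1 = {\<tau>\<in>T. f \<tau> \<in> L}"
  define T2 where "T2 = {\<tau>\<in>T. f \<tau> \<notin> L \<and> g \<tau> \<in> L}"
  define T3 where "T3 = {\<tau>\<in>T. f \<tau> \<notin> L \<and> g \<tau> \<notin> L}"
  have T: "T = T1 \<union> T2 \<union> T3" "finite T1" "finite T2" "finite T3"
    and sub: "f ` T1 \<subseteq> L" "g ` T2 \<subseteq> L" "h ` T3 \<subseteq> L"
    using fin(1) L by (auto simp: T1_def T2_def T3_def)
  have disj: "T1 \<inter> T2 = {}" "(T1 \<union> T2) \<inter> T3 = {}" by (auto simp: T1_def T2_def T3_def)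
  have "F x y z =
        (\<Sum>a\<in>L. \<phi> a x * (\<Sum>\<tau> | \<tau> \<in> T1 \<and> f \<tau> = a. \<psi> (g \<tau>) y * \<chi> (h \<tau>) z))
      + (\<Sum>b\<in>L. \<psi> b y * (\<Sum>\<tau> | \<tau> \<in> T2 \<and> g \<tau> = b. \<phi> (f \<tau>) x * \<chi> (h \<tau>) z))
      + (\<Sum>c\<in>L. \<chi> c z * (\<Sum>\<tau> | \<tau> \<in> T3 \<and> h \<tau> = c. \<phi> (f \<tau>) x * \<psi> (g \<tau>) y))"
    if "x \<in> Z" "y \<in> Z" "z \<in> Z" for x y z
  proof -
    let ?t = "\<lambda>\<tau>. \<phi> (f \<tau>) x * \<psi> (g \<tau>) y * \<chi> (h \<tau>) z"
    have "F x y z = sum ?t T1 + sum ?t T2 + sum ?t T3"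
      using F[OF that] T disj by (simp add: sum.union_disjoint)
    also have "sum ?t T1 = (\<Sum>a\<in>L. \<Sum>\<tau> | \<tau> \<in> T1 \<and> f \<tau> = a. ?t \<tau>)"
      by (rule sum.group[OF T(2) fin(2) sub(1), symmetric])
    also have "sum ?t T2 = (\<Sum>b\<in>L. \<Sum>\<tau> | \<tau> \<in> T2 \<and> g \<tau> = b. ?t \<tau>)"
      by (rule sum.group[OF T(3) fin(2) sub(2), symmetric])
    also have "sum ?t T3 = (\<Sum>c\<in>L. \<Sum>\<tau> | \<tau> \<in> T3 \<and> h \<tau> = c. ?t \<tau>)"
      by (rule sum.group[OF T(4) fin(2) sub(3), symmetric])
    finally show ?thesis by (simp add: sum_distrib_left mult_ac)
  qed
  from slice_rank_diagonal[OF Z fin(2) fin(2) fin(2) p this diag] show ?thesis by simp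
qed

section \<open>The indicator of zero as a polynomial modulo p\<close>

lemma prime_dvd_cofactor:
  fixes p :: nat
  assumes "Factorial_Ring.prime p" "p ^ a dvd s * c" "\<not> p ^ a dvd s"
  shows "p dvd c"
  using assms by (metis coprime_dvd_mult_left_iff coprime_power_left_iff prime_imp_coprime)

lemma alternating_binomial_partial_sum:
  "(\<Sum>k<Suc r. (- 1) ^ k * int (Suc n choose k)) = (- 1) ^ r * int (n choose r)"
  by (induction r) (simp_all add: algebra_simps)

text \<open>If \<open>p ^ a\<close> divides \<open>n\<close>, then \<open>k * (n choose k)\<close>
  is a multiple of \<open>p ^ a\<close>, so \<open>p\<close> divides every term except the one for
  \<open>k = 0\<close>, and 1 remains. Otherwise the sum is up to sign
  \<open>(n - 1) choose (p ^ a - 1)\<close>, which is divisible by \<open>p\<close> by absorption.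
  As a function of \<open>n\<close> the sum is a polynomial of degree
  \<open>p ^ a - 1\<close>.\<close>

lemma alternating_binomial_sum_dvd_iff:
  fixes p :: nat
  assumes p: "Factorial_Ring.prime p"
  shows "int p dvd (\<Sum>k<p ^ a. (- 1) ^ k * int (n choose k)) \<longleftrightarrow> \<not> p ^ a dvd n"
proof -
  obtain r where r: "p ^ a = Suc r"
    using p by (metis not0_implies_Suc power_not_zero not_prime_0)
  show ?thesis
  proof (cases "p ^ a dvd n")
    case True
    have "p dvd n choose k" if k: "0 < k" "k < p ^ a" for k
    proof (cases n)
      case (Suc n')
      obtain k' where k': "k = Suc k'" using k by (cases k) auto
      have "k * (n choose k) = n * (n' choose k')"
        unfolding Suc k' using Suc_times_binomial by blast
      moreover have "\<not> p ^ a dvd k" using k by (auto dest: dvd_imp_le)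
      ultimately show ?thesis using p True
        by (metis prime_dvd_cofactor dvd_mult2)
    qed (use k in \<open>simp add: binomial_eq_0\<close>)
    then have "int p dvd (\<Sum>k\<in>{..<p ^ a} - {0}. (- 1) ^ k * int (n choose k))"
      by (intro dvd_sum) (auto intro!: dvd_mult)
    moreover have "(\<Sum>k<p ^ a. (- 1) ^ k * int (n choose k))
        = 1 + (\<Sum>k\<in>{..<p ^ a} - {0}. (- 1) ^ k * int (n choose k))"
      using p by (subst sum.remove[of _ 0]) (auto simp: prime_gt_0_nat)
    moreover have "\<not> int p dvd 1" using p by (metis not_prime_unit prime_nat_int_transfer)
    ultimately show ?thesis using True by (simp add: dvd_add_left_iff)
  next
    case False
    then obtain n' where n': "n = Suc n'" by (metis dvd_0_right not0_implies_Suc)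
    have "p ^ a dvd n * (n' choose r)"
      unfolding r n' by (metis Suc_times_binomial dvd_triv_left)
    then have "p dvd n' choose r" using p False prime_dvd_cofactor by blast
    then show ?thesis using False unfolding r n' alternating_binomial_partial_sum by simp
  qed
qed

lemma sum_simplex3:
  fixes F G H :: "nat \<Rightarrow> int"
  shows "(\<Sum>(a, b, c) | a + b + c < q. F a * G b * H c)
    = (\<Sum>k<q. \<Sum>i\<le>k. (\<Sum>j\<le>i. F j * G (i - j)) * H (k - i))"
proof -
  have "(\<Sum>k<q. \<Sum>i\<le>k. (\<Sum>j\<le>i. F j * G (i - j)) * H (k - i))
      = (\<Sum>(k, i, j)\<in>(SIGMA k:{..<q}. SIGMA i:{..k}. {..i}). F j * G (i - j) * H (k - i))"
    by (simp add: sum.Sigma sum_distrib_right)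
  also have "\<dots> = (\<Sum>(a, b, c) | a + b + c < q. F a * G b * H c)"
    by (rule sum.reindex_bij_witness[of _ "\<lambda>(a, b, c). (a + b + c, a + b, a)"
          "\<lambda>(k, i, j). (j, i - j, k - i)"]) auto
  finally show ?thesis ..
qed

text \<open>Two nested applications of Vandermonde's identity separate the three variables of the
  indicator polynomial. Every term has \<open>a + b + c < q\<close>, which is the degree bound used
  later.\<close>

lemma alternating_vandermonde3:
  "(\<Sum>(a, b, c) | a + b + c < q. ((- 1) ^ a * int (l choose a)) * ((- 1) ^ b * int (m choose b))
      * ((- 1) ^ c * int (n choose c)))
    = (\<Sum>k<q. (- 1) ^ k * int ((l + m + n) choose k))"
proof -
  have V: "(\<Sum>i\<le>k. ((- 1) ^ i * int (u choose i)) * ((- 1) ^ (k - i) * int (v choose (k - i))))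
      = (- 1) ^ k * int ((u + v) choose k)" for u v k
  proof -
    have "(\<Sum>i\<le>k. ((- 1) ^ i * int (u choose i)) * ((- 1) ^ (k - i) * int (v choose (k - i))))
      = (\<Sum>i\<le>k. (- 1) ^ k * int ((u choose i) * (v choose (k - i))))"
      by (intro sum.cong refl) (simp add: mult_ac flip: power_add)
    also have "\<dots> = (- 1) ^ k * int (\<Sum>i\<le>k. (u choose i) * (v choose (k - i)))"
      by (simp add: sum_distrib_left)
    finally show ?thesis by (simp add: vandermonde)
  qed
  show ?thesis unfolding sum_simplex3 V ..
qed

text \<open>Separates the variables in coordinates where no degree bound is sought: only the triple
  of the actual residues can contribute, and it belongs to the index set exactly when
  \<open>q\<close> divides the sum.\<close>

lemma residue_indicator_sum3:
  fixes q :: nat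
  assumes "q > 0"
  shows "(\<Sum>(a, b, c)\<in>{(a, b, c). a < q \<and> b < q \<and> c < q \<and> q dvd a + b + c}.
      of_bool (l mod q = a) * of_bool (m mod q = b) * of_bool (n mod q = c))
    = (of_bool (q dvd l + m + n) :: int)"
proof -
  let ?T = "{(a, b, c). a < q \<and> b < q \<and> c < q \<and> q dvd a + b + c}"
  have "?T \<subseteq> {..<q} \<times> {..<q} \<times> {..<q}" by auto
  then have fin: "finite ?T" by (rule finite_subset) auto
  have "(\<Sum>(a, b, c)\<in>?T. of_bool (l mod q = a) * of_bool (m mod q = b) * of_bool (n mod q = c))
    = (\<Sum>\<tau>\<in>?T. if \<tau> = (l mod q, m mod q, n mod q) then 1 else 0 :: int)"
    by (intro sum.cong) auto
  also have "\<dots> = of_bool (q dvd l mod q + m mod q + n mod q)"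
    using fin assms by (auto simp: sum.delta)
  also have "q dvd l mod q + m mod q + n mod q \<longleftrightarrow> q dvd l + m + n"
  proof -
    have "(l mod q + m mod q + n mod q) mod q = ((l mod q + m mod q) mod q + n mod q) mod q"
      by (simp only: mod_add_left_eq[of "l mod q + m mod q"])
    also have "\<dots> = (l + m + n) mod q" by (simp only: mod_add_eq)
    finally show ?thesis by (simp only: dvd_eq_mod_eq_0)
  qed
  finally show ?thesis .
qed

section \<open>Counting exponent vectors of low weight\<close>

text \<open>Dividing by \<open>q i - 1\<close> scales each degree to the unit interval. The
  threshold \<open>card P / 3\<close> is met by at least one of any three vectors of total weight at
  most \<open>card P\<close>. Coordinates outside \<open>P\<close> carry no weight.\<close>

definition low_weight :: "('i \<Rightarrow> nat) \<Rightarrow> 'i set \<Rightarrow> 'i set \<Rightarrow> ('i \<Rightarrow> nat) set" where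
  "low_weight q I P = {e \<in> \<Pi>\<^sub>E i\<in>I. {..<q i}.
     3 * (\<Sum>i\<in>P. real (e i) / real (q i - 1)) \<le> real (card P)}"

lemma two_powr_minus_le:
  fixes t :: real
  assumes "0 \<le> t" "t \<le> 1"
  shows "2 powr - t \<le> 1 - t / 2"
proof -
  have "exp ((1 - t) *\<^sub>R 0 + t *\<^sub>R - ln 2) \<le> (1 - t) * exp 0 + t * exp (- ln 2 :: real)"
    by (rule convex_onD[OF exp_convex]) (use assms in auto)
  also have "exp (- ln 2 :: real) = 1 / 2" by (simp add: exp_minus inverse_eq_divide)
  finally show ?thesis by (simp add: powr_def field_simps)
qed

text \<open>The chord bound is averaged: \<open>k / (q - 1)\<close> has mean 1/2 over
  \<open>k < q\<close>, and \<open>1 - 1/4 = 3/4\<close>.\<close>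

lemma sum_two_powr_le:
  fixes q :: nat
  assumes "1 < q"
  shows "(\<Sum>k<q. 2 powr - (real k / real (q - 1))) \<le> 3 / 4 * real q"
proof -
  obtain r where r: "q = Suc r" "0 < r" using assms by (cases q) auto
  have "(\<Sum>k<q. 2 powr - (real k / real (q - 1))) \<le> (\<Sum>k<q. 1 - real k / real r / 2)"
  proof (rule sum_mono)
    fix k assume "k \<in> {..<q}"
    then show "2 powr - (real k / real (q - 1)) \<le> 1 - real k / real r / 2"
      using r two_powr_minus_le[of "real k / real r"] by simp
  qed
  also have "\<dots> = real q - (\<Sum>k<q. real k) / (2 * real r)"
    by (simp add: sum_subtractf sum_divide_distrib mult.commute)
  also have "(\<Sum>k<q. real k) = real q * real r / 2"
    unfolding r by (induction r) (simp_all add: field_simps)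
  also have "real q - real q * real r / 2 / (2 * real r) = 3 / 4 * real q" using r by (simp add: field_simps)
  finally show ?thesis .
qed

lemma card_low_weight_le:
  assumes I: "finite I" "P \<subseteq> I" and q: "\<And>i. i \<in> P \<Longrightarrow> 1 < q i"
  shows "real (card (low_weight q I P))
    \<le> (\<Prod>i\<in>I. real (q i)) * (3 / 4 * 2 powr (1 / 3)) ^ card P"
proof -
  have P: "finite P" using I by (rule finite_subset[rotated])
  let ?E = "\<Pi>\<^sub>E i\<in>I. {..<q i}"
  define w where "w e = (\<Sum>i\<in>P. real (e i) / real (q i - 1))" for e
  have E: "finite ?E" using I by (intro finite_PiE) auto
  have "real (card (low_weight q I P)) = (\<Sum>e\<in>low_weight q I P. 1)" by simp
  \<comment> \<open>On vectors of low weight the exponent is nonnegative, so each counts at least 1.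
    The sum is then extended to the whole box, where it factors over the coordinates.\<close>
  also have "\<dots> \<le> (\<Sum>e\<in>low_weight q I P. 2 powr (real (card P) / 3 - w e))"
    by (intro sum_mono ge_one_powr_ge_zero) (auto simp: low_weight_def w_def)
  also have "\<dots> \<le> (\<Sum>e\<in>?E. 2 powr (real (card P) / 3 - w e))"
    by (intro sum_mono2 E) (auto simp: low_weight_def)
  also have "\<dots> = (\<Sum>e\<in>?E. \<Prod>i\<in>I. if i \<in> P
      then 2 powr (1 / 3) * 2 powr - (real (e i) / real (q i - 1)) else 1)"
  proof (intro sum.cong refl)
    fix e
    have "2 powr (real (card P) / 3 - w e)
        = 2 powr (\<Sum>i\<in>P. 1 / 3 + - (real (e i) / real (q i - 1)))"
      by (simp add: w_def sum_subtractf)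
    also have "\<dots> = (\<Prod>i\<in>P. 2 powr (1 / 3) * 2 powr - (real (e i) / real (q i - 1)))"
      using P by (simp only: powr_sum powr_add)
    also have "\<dots> = (\<Prod>i\<in>I. if i \<in> P
      then 2 powr (1 / 3) * 2 powr - (real (e i) / real (q i - 1)) else 1)"
      using I by (intro prod.mono_neutral_cong_left) auto
    finally show "2 powr (real (card P) / 3 - w e) = \<dots>" .
  qed
  also have "\<dots> = (\<Prod>i\<in>I. \<Sum>k<q i. if i \<in> P
      then 2 powr (1 / 3) * 2 powr - (real k / real (q i - 1)) else 1)"
    using I by (intro prod_sum_PiE[symmetric]) auto
  also have "\<dots> \<le> (\<Prod>i\<in>I. real (q i) * (if i \<in> P then 3 / 4 * 2 powr (1 / 3) else 1))"
  proof (intro prod_mono conjI)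
    fix i assume i: "i \<in> I"
    show "0 \<le> (\<Sum>k<q i. if i \<in> P then 2 powr (1 / 3) * 2 powr - (real k / real (q i - 1)) else 1)"
      by (intro sum_nonneg) auto
    have "2 powr (1 / 3) * (\<Sum>k<q i. 2 powr - (real k / real (q i - 1)))
        \<le> 2 powr (1 / 3) * (3 / 4 * real (q i))" if "i \<in> P"
      using sum_two_powr_le[OF q[OF that]] by (intro mult_left_mono) auto
    then show "(\<Sum>k<q i. if i \<in> P then 2 powr (1 / 3) * 2 powr - (real k / real (q i - 1)) else 1)
        \<le> real (q i) * (if i \<in> P then 3 / 4 * 2 powr (1 / 3) else 1)"
      by (auto simp: sum_distrib_left mult_ac)
  qed
  also have "\<dots> = (\<Prod>i\<in>I. real (q i)) * (3 / 4 * 2 powr (1 / 3)) ^ card P"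
    using I by (simp add: prod.distrib prod.If_cases Int_absorb1)
  finally show ?thesis .
qed

text \<open>By \<open>match\<close>, the product over \<open>I\<close> of the coordinatewise
  indicators is diagonal modulo \<open>p\<close>. Multiplied out, each term has separated variables
  and three exponent vectors of total weight at most \<open>card P\<close>, so one of them has low
  weight.\<close>

lemma card_le_low_weight:
  fixes s t u :: "'x \<Rightarrow> 'i \<Rightarrow> nat" and p :: nat
  assumes Z: "finite Z" and I: "finite I" "P \<subseteq> I" and p: "Factorial_Ring.prime p"
    and q: "\<And>i. i \<in> I \<Longrightarrow> 0 < q i" and qP: "\<And>i. i \<in> P \<Longrightarrow> 1 < q i \<and> (\<exists>a. q i = p ^ a)"
    and match: "\<And>x y z. \<lbrakk>x \<in> Z; y \<in> Z; z \<in> Z\<rbrakk> \<Longrightarrow>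
      (\<forall>i\<in>I. q i dvd s x i + t y i + u z i) \<longleftrightarrow> x = y \<and> y = z"
  shows "card Z \<le> 3 * card (low_weight q I P)"
proof -
  have P: "finite P" using I by (rule finite_subset[rotated])
  \<comment> \<open>\<open>\<kappa>\<close> holds the one-variable factors and \<open>T\<close> the
    index triples of one coordinate: a simplex for the binomials on \<open>P\<close>, residue
    triples elsewhere.\<close>
  define \<kappa> where "\<kappa> i a n =
    (if i \<in> P then (- 1) ^ a * int (n choose a) else of_bool (n mod q i = a))" for i a n
  define T where "T i = (if i \<in> P then {(a, b, c). a + b + c < q i}
    else {(a, b, c). a < q i \<and> b < q i \<and> c < q i \<and> q i dvd a + b + c})" for i
  define G where "G i l m n = (\<Sum>\<tau>\<in>T i. \<kappa> i (fst \<tau>) l * \<kappa> i (fst (snd \<tau>)) m * \<kappa> i (snd (snd \<tau>)) n)"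
    for i l m n
  define F where "F x y z = (\<Prod>i\<in>I. G i (s x i) (t y i) (u z i))" for x y z
  have Tsub: "T i \<subseteq> {..<q i} \<times> {..<q i} \<times> {..<q i}" for i by (auto simp: T_def)
  have Tfin: "finite (T i)" for i using Tsub by (rule finite_subset) auto
  have G: "int p dvd G i l m n \<longleftrightarrow> \<not> q i dvd l + m + n" if "i \<in> I" for i l m n
  proof (cases "i \<in> P")
    case True
    then obtain a where a: "q i = p ^ a" using qP by blast
    have "G i l m n = (\<Sum>k<q i. (- 1) ^ k * int ((l + m + n) choose k))"
      using True by (simp add: G_def T_def \<kappa>_def alternating_vandermonde3[symmetric] case_prod_beta)
    then show ?thesis unfolding a by (simp only: alternating_binomial_sum_dvd_iff[OF p])
  next
    case False
    have "G i l m n = of_bool (q i dvd l + m + n)"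
      using False residue_indicator_sum3[OF q[OF that], of l m n]
      by (simp add: G_def T_def \<kappa>_def case_prod_beta)
    moreover have "\<not> int p dvd 1" using p by (metis not_prime_unit prime_nat_int_transfer)
    ultimately show ?thesis by simp
  qed
  let ?f = "\<lambda>\<tau>. \<lambda>i\<in>I. fst (\<tau> i)"
  let ?g = "\<lambda>\<tau>. \<lambda>i\<in>I. fst (snd (\<tau> i))"
  let ?h = "\<lambda>\<tau>. \<lambda>i\<in>I. snd (snd (\<tau> i))"
  show ?thesis
  proof (rule slice_rank_bound[OF Z _ _ p, where F = F and T = "Pi\<^sub>E I T" and f = ?f and g = ?g and h = ?h
        and \<phi> = "\<lambda>e x. \<Prod>i\<in>I. \<kappa> i (e i) (s x i)" and \<psi> = "\<lambda>e x. \<Prod>i\<in>I. \<kappa> i (e i) (t x i)"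
        and \<chi> = "\<lambda>e x. \<Prod>i\<in>I. \<kappa> i (e i) (u x i)"])
    show "finite (Pi\<^sub>E I T)" using I Tfin by (intro finite_PiE) auto
    show "finite (low_weight q I P)" unfolding low_weight_def
      using I by (intro finite_subset[OF _ finite_PiE[of I "\<lambda>i. {..<q i}"]]) auto
  next
    fix x y z
    show "F x y z = (\<Sum>\<tau>\<in>Pi\<^sub>E I T. (\<Prod>i\<in>I. \<kappa> i (?f \<tau> i) (s x i)) * (\<Prod>i\<in>I. \<kappa> i (?g \<tau> i) (t y i))
        * (\<Prod>i\<in>I. \<kappa> i (?h \<tau> i) (u z i)))"
      unfolding F_def G_def using I Tfin by (simp add: prod_sum_PiE prod.distrib)
  next
    fix \<tau> assume \<tau>: "\<tau> \<in> Pi\<^sub>E I T"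
    let ?w = "\<lambda>e. \<Sum>i\<in>P. real (e i) / real (q i - 1)"
    have "?w (?f \<tau>) + ?w (?g \<tau>) + ?w (?h \<tau>)
        = (\<Sum>i\<in>P. (real (fst (\<tau> i)) + real (fst (snd (\<tau> i))) + real (snd (snd (\<tau> i)))) / real (q i - 1))"
      using I by (simp add: add_divide_distrib sum.distrib subset_iff)
    also have "\<dots> \<le> (\<Sum>i\<in>P. 1)"
    proof (rule sum_mono)
      fix i assume i: "i \<in> P"
      then have "\<tau> i \<in> T i" using \<tau> I by auto
      then have "fst (\<tau> i) + fst (snd (\<tau> i)) + snd (snd (\<tau> i)) \<le> q i - 1"
        using i by (auto simp: T_def)
      then have "real (fst (\<tau> i)) + real (fst (snd (\<tau> i))) + real (snd (snd (\<tau> i))) \<le> real (q i - 1)"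
        by (simp only: of_nat_le_iff flip: of_nat_add)
      then show "(real (fst (\<tau> i)) + real (fst (snd (\<tau> i))) + real (snd (snd (\<tau> i)))) / real (q i - 1) \<le> 1"
        using qP[OF i] by (simp only: divide_le_eq_1) simp
    qed
    finally have "3 * ?w (?f \<tau>) \<le> real (card P) \<or> 3 * ?w (?g \<tau>) \<le> real (card P)
        \<or> 3 * ?w (?h \<tau>) \<le> real (card P)" by (simp, linarith)
    moreover have "?f \<tau> \<in> (\<Pi>\<^sub>E i\<in>I. {..<q i})" "?g \<tau> \<in> (\<Pi>\<^sub>E i\<in>I. {..<q i})" "?h \<tau> \<in> (\<Pi>\<^sub>E i\<in>I. {..<q i})"
      using \<tau> Tsub by (fastforce simp: PiE_def Pi_def)+
    ultimately show "?f \<tau> \<in> low_weight q I P \<or> ?g \<tau> \<in> low_weight q I P \<or> ?h \<tau> \<in> low_weight q I P"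
      unfolding low_weight_def by blast
  next
    fix x y z assume "x \<in> Z" "y \<in> Z" "z \<in> Z"
    then show "int p dvd F x y z \<longleftrightarrow> \<not> (x = y \<and> y = z)"
      using p I G unfolding F_def by (simp add: prime_dvd_prod_iff match[symmetric])
  qed
qed

section \<open>Chebyshev's bound\<close>

definition lcm_upto :: "nat \<Rightarrow> nat" where
  "lcm_upto n = Lcm {1..n}"

lemma lcm_upto_pos: "lcm_upto n > 0"
  unfolding lcm_upto_def by (rule Nat.gr0I) (simp add: Lcm_0_iff_nat)

lemma dvd_lcm_upto: "0 < j \<Longrightarrow> j \<le> n \<Longrightarrow> j dvd lcm_upto n"
  by (simp add: lcm_upto_def dvd_Lcm)

lemma lcm_upto_mono: "m \<le> n \<Longrightarrow> lcm_upto m dvd lcm_upto n"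
  unfolding lcm_upto_def by (rule Lcm_subset) auto

text \<open>Induction along Leibniz's harmonic triangle: the reciprocals \<open>l n i\<close> of
  \<open>i * (n choose i)\<close> satisfy \<open>l n (i + 1) = l (n - 1) i - l n i\<close>.\<close>

lemma mult_binomial_dvd_lcm_upto:
  assumes "0 < i" "i \<le> n"
  shows "i * (n choose i) dvd lcm_upto n"
proof -
  \<comment> \<open>Divisibility is phrased as an integral quotient because the recursion subtracts
    unit fractions. The shifted index lets the induction start at 1.\<close>
  have *: "\<exists>z::int. real (lcm_upto n) / (real (Suc i) * real (n choose Suc i)) = z" if "i < n" for i
    using that
  proof (induction i arbitrary: n)
    case 0
    then have "n dvd lcm_upto n" by (intro dvd_lcm_upto) auto
    then obtain k where "lcm_upto n = n * k" by (elim dvdE)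
    then have "real (lcm_upto n) / (real (Suc 0) * real (n choose Suc 0)) = real_of_int (int k)"
      using 0 by simp
    then show ?case ..
  next
    case (Suc i)
    then obtain n' where n': "n = Suc n'" "i < n'" by (cases n) auto
    let ?L = "real (lcm_upto n)"
    obtain z1 :: int where z1: "?L / (real (Suc i) * real (n choose Suc i)) = z1"
      using Suc.IH[of n] Suc.prems by auto
    obtain z2 :: int where z2: "real (lcm_upto n') / (real (Suc i) * real (n' choose Suc i)) = z2"
      using Suc.IH[of n'] n' by auto
    obtain d where d: "lcm_upto n = lcm_upto n' * d" using lcm_upto_mono[of n' n] n' by auto
    have pos: "real (n' choose Suc i) > 0" "real (n choose Suc i) > 0" "real (n choose Suc (Suc i)) > 0"
      using n' Suc.prems by (auto simp only: of_nat_0_less_iff zero_less_binomial_iff)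
    define a where "a = real (n' choose Suc i)"
    define b where "b = real (n choose Suc i)"
    define c where "c = real (n choose Suc (Suc i))"
    have "Suc (Suc i) * (n choose Suc (Suc i)) = n * (n' choose Suc i)"
      unfolding n' by (rule Suc_times_binomial)
    then have c: "(real i + 2) * c = real n * a"
      unfolding a_def c_def by (metis add_2_eq_Suc' of_nat_Suc of_nat_add of_nat_mult of_nat_numeral)
    have "(n - Suc i) * (n choose Suc i) = n * (n' choose Suc i)"
      using binomial_absorb_comp[of n "Suc i"] n' by simp
    then have b: "(real n - real i - 1) * b = real n * a"
    proof -
      have "real (n - Suc i) * b = real n * a"
        unfolding a_def b_def of_nat_mult[symmetric]
        using \<open>(n - Suc i) * (n choose Suc i) = n * (n' choose Suc i)\<close> by (rule arg_cong)
      then show ?thesis using Suc.prems by (simp add: of_nat_diff algebra_simps)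
    qed
    \<comment> \<open>Leibniz's recursion multiplied by \<open>lcm_upto n\<close>. Absorption
      expresses \<open>b\<close> and \<open>c\<close> through \<open>a\<close>, and the term with
      \<open>a\<close> stays integral because \<open>lcm_upto n'\<close> divides
      \<open>lcm_upto n\<close>.\<close>
    have "?L / (real (Suc (Suc i)) * c) = ?L / (real (Suc i) * a) - ?L / (real (Suc i) * b)"
    proof -
      have n0: "real n > 0" using n' by simp
      have "1 / b = (real n - real i - 1) / (real n * a)"
        using b pos n0 by (simp add: a_def b_def field_simps)
      then have "?L / (real (Suc i) * b) = ?L / real (Suc i) * ((real n - real i - 1) / (real n * a))"
        by (metis divide_divide_eq_left mult.right_neutral times_divide_eq_right)
      moreover have "?L / (real (Suc (Suc i)) * c) = ?L / (real n * a)"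
        using c by (simp add: add.commute)
      moreover have "l / (v * a) = l / (w * a) - l / w * ((v - w) / (v * a))"
        if "v > 0" "w > 0" "a > 0" for l v w a :: real
        using that by (simp add: field_simps)
      from this[of "real n" "real (Suc i)" a ?L] have "?L / (real n * a)
          = ?L / (real (Suc i) * a) - ?L / real (Suc i) * ((real n - real i - 1) / (real n * a))"
        using pos(1) n0 by (simp add: a_def diff_diff_eq add.commute)
      ultimately show ?thesis by simp
    qed
    moreover have "?L / (real (Suc i) * a) = real d * z2"
      unfolding z2[symmetric] a_def d by simp
    ultimately have "?L / (real (Suc (Suc i)) * c) = real_of_int (int d * z2 - z1)"
      using z1 unfolding b_def by simp
    then show ?case unfolding c_def ..
  qed
  obtain i' where i': "i = Suc i'" using assms by (cases i) auto
  obtain z :: int where "real (lcm_upto n) / (real i * real (n choose i)) = z"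
    using *[of i'] assms unfolding i' by auto
  moreover have "real i * real (n choose i) \<noteq> 0" using assms by auto
  ultimately have "real (lcm_upto n) = z * (real i * real (n choose i))"
    by (metis nonzero_divide_eq_eq)
  then have "real_of_int (int (lcm_upto n)) = real_of_int (z * int (i * (n choose i)))" by simp
  then have "int (lcm_upto n) = z * int (i * (n choose i))" by (simp only: of_int_eq_iff)
  then have "int (i * (n choose i)) dvd int (lcm_upto n)" by simp
  then show ?thesis by (simp only: of_nat_dvd_iff)
qed

text \<open>Numbers \<open>j \<le> b\<close> already divide \<open>lcm_upto b\<close>. For
  \<open>j > b \<ge> a\<close>, the product
  \<open>(j - a) * (b choose (j - a)) * ((a + b) choose a)\<close> equals
  \<open>((a + b) choose j) * j * ((j - 1) choose a)\<close>, a multiple of \<open>j\<close>, and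
  the product of its first two factors divides \<open>lcm_upto b\<close>.\<close>

lemma lcm_upto_add_dvd:
  assumes "a \<le> b"
  shows "lcm_upto (a + b) dvd lcm_upto b * ((a + b) choose a)"
  unfolding lcm_upto_def[of "a + b"]
proof (rule Lcm_least)
  fix j assume j: "j \<in> {1..a + b}"
  show "j dvd lcm_upto b * ((a + b) choose a)"
  proof (cases "j \<le> b")
    case True
    then show ?thesis using j by (intro dvd_mult2 dvd_lcm_upto) auto
  next
    case False
    then have ja: "a < j" "j - a \<le> b" using j assms by auto
    obtain j' where j': "j = Suc j'" using ja by (cases j) auto
    have 1: "((a + b) choose j) * (j choose a) = ((a + b) choose a) * (b choose (j - a))"
      using choose_mult[of a j "a + b"] ja j by simp
    have 2: "(j - a) * (j choose a) = j * (j' choose a)"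
      using binomial_absorb_comp[of j a] j' by simp
    have "j dvd (j - a) * (b choose (j - a)) * ((a + b) choose a)"
    proof -
      have "(j - a) * (b choose (j - a)) * ((a + b) choose a)
          = ((a + b) choose j) * ((j - a) * (j choose a))"
        using 1 by (simp add: mult_ac)
      then show ?thesis unfolding 2 by simp
    qed
    moreover have "(j - a) * (b choose (j - a)) dvd lcm_upto b"
      using ja by (intro mult_binomial_dvd_lcm_upto) auto
    ultimately show ?thesis by (meson dvd_trans mult_dvd_mono dvd_refl)
  qed
qed

text \<open>Strong induction by halving: the larger half \<open>b\<close> falls under the induction
  hypothesis, and the central coefficient \<open>n choose a\<close> contributes at most
  \<open>4 ^ a\<close>.\<close>

lemma lcm_upto_le: "lcm_upto n \<le> 4 ^ n"
proof (induction n rule: less_induct)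
  case (less n)
  show ?case
  proof (cases "n \<le> 1")
    case True
    then have "lcm_upto n = 1" by (cases n) (auto simp: lcm_upto_def)
    then show ?thesis by simp
  next
    case False
    define a where "a = n div 2"
    define b where "b = n - a"
    have ab: "a \<le> b" "b \<le> Suc a" "a + b = n" "b < n" using False by (auto simp: a_def b_def)
    have "(n choose a) \<le> 4 ^ a"
    proof (cases "a = b")
      case True
      have "(n choose a) \<le> 2 ^ n" by (rule binomial_le_pow2)
      then show ?thesis using ab True by (simp add: power_mult mult_2[symmetric] flip: ab(3))
    next
      case F: False
      \<comment> \<open>For odd \<open>n\<close> the two equal central coefficients together are at
        most \<open>2 ^ n\<close>, which saves the factor 2 brought by
        \<open>n = 2 * a + 1\<close>.\<close>
      have "n choose b = n choose a"
        using binomial_symmetric[of a n] ab by (metis b_def le_add1)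
      then have "2 * (n choose a) = (\<Sum>k\<in>{a, b}. n choose k)" using F by simp
      also have "\<dots> \<le> (\<Sum>k\<le>n. n choose k)" using ab by (intro sum_mono2) auto
      also have "\<dots> = 2 ^ n" by (rule choose_row_sum)
      also have "(2 :: nat) ^ n = 2 * 4 ^ a"
      proof -
        have "n = Suc (2 * a)" using F ab by auto
        then show ?thesis by (simp add: power_mult)
      qed
      finally show ?thesis by simp
    qed
    moreover have "lcm_upto b \<le> 4 ^ b" using less ab by simp
    moreover have "lcm_upto n \<le> lcm_upto b * (n choose a)"
      using lcm_upto_add_dvd[of a b] ab by (intro dvd_imp_le) (auto simp: lcm_upto_pos)
    ultimately have "lcm_upto n \<le> 4 ^ b * 4 ^ a" by (meson mult_le_mono le_trans)
    then show ?thesis using ab by (simp add: power_add[symmetric] add.commute)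
  qed
qed

section \<open>Primary decomposition of finite abelian groups\<close>

context comm_group
begin

section \<open>Products of powers and generated subgroups\<close>

lemma finprod_in_subgroup:
  assumes "subgroup K G" "finite A" "f \<in> A \<rightarrow> K"
  shows "finprod G f A \<in> K"
  using assms(2,3)
proof (induction A rule: finite_induct)
  case empty
  then show ?case using assms(1) by (simp add: subgroup.one_closed)
next
  case (insert a A)
  have "f a \<in> K" "f \<in> A \<rightarrow> K" using insert.prems by auto
  moreover have "K \<subseteq> carrier G" by (rule subgroup.subset[OF assms(1)])
  ultimately have "finprod G f (insert a A) = f a \<otimes> finprod G f A"
    using insert.hyps by (intro finprod_insert) auto
  then show ?case using \<open>f a \<in> K\<close> insert.IH[OF \<open>f \<in> A \<rightarrow> K\<close>] assms(1)
    by (simp add: subgroup.m_closed)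
qed

lemma finprod_nat_pow:
  assumes "f \<in> A \<rightarrow> carrier G"
  shows "(\<Otimes>i\<in>A. f i [^] (n :: nat)) = finprod G f A [^] n"
proof (induction n)
  case (Suc n)
  have "(\<lambda>i. f i [^] n) \<in> A \<rightarrow> carrier G" using assms by (auto simp: Pi_def)
  then show ?case using Suc assms by simp
qed simp

lemma subgroup_nat_pow_closed:
  "subgroup K G \<Longrightarrow> x \<in> K \<Longrightarrow> x [^] (n :: nat) \<in> K"
  by (induction n) (auto simp: subgroup.one_closed subgroup.m_closed)

text \<open>Bezout's identity in natural numbers, where the subtracted multiple of \<open>b\<close>
  becomes an inverse in \<open>K\<close>.\<close>

lemma subgroup_pow_gcd:
  fixes a b :: nat
  assumes K: "subgroup K G" and x: "x \<in> carrier G" "x [^] a \<in> K" "x [^] b \<in> K"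
  shows "x [^] gcd a b \<in> K"
proof (cases "a = 0")
  case False
  then obtain u v where uv: "a * u = b * v + gcd a b" using bezout_nat by blast
  have "(x [^] a) [^] u = (x [^] b) [^] v \<otimes> x [^] gcd a b"
    using x(1) uv by (simp add: nat_pow_pow nat_pow_mult)
  then have "x [^] gcd a b = inv ((x [^] b) [^] v) \<otimes> (x [^] a) [^] u"
    using x(1) by (simp add: m_assoc[symmetric])
  then show ?thesis using K x
    by (simp add: subgroup.m_closed subgroup.m_inv_closed subgroup_nat_pow_closed)
qed (use x in simp)

lemma finprod_pow_add:
  fixes m n :: "'i \<Rightarrow> nat"
  assumes "g \<in> I \<rightarrow> carrier G"
  shows "(\<Otimes>i\<in>I. g i [^] (m i + n i)) = (\<Otimes>i\<in>I. g i [^] m i) \<otimes> (\<Otimes>i\<in>I. g i [^] n i)"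
proof -
  have "(\<Otimes>i\<in>I. g i [^] (m i + n i)) = (\<Otimes>i\<in>I. g i [^] m i \<otimes> g i [^] n i)"
    using assms by (intro finprod_cong') (auto simp: nat_pow_mult Pi_def)
  then show ?thesis using assms by (simp add: Pi_def)
qed

text \<open>The products of natural powers form a subgroup containing the generators. Inverses come
  from multiplying the exponents by \<open>order G - 1\<close>, so no negative exponents
  occur.\<close>

lemma generate_eq_finprod_pow:
  assumes fin: "finite (carrier G)" "finite I" and g: "g \<in> I \<rightarrow> carrier G"
    and x: "x \<in> generate G (g ` I)"
  obtains n :: "'i \<Rightarrow> nat" where "x = (\<Otimes>i\<in>I. g i [^] n i)"
proof -
  define W where "W = range (\<lambda>n :: 'i \<Rightarrow> nat. \<Otimes>i\<in>I. g i [^] n i)"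
  have g': "(\<lambda>i. g i [^] n i) \<in> I \<rightarrow> carrier G" for n :: "'i \<Rightarrow> nat" using g by (auto simp: Pi_def)
  have "subgroup W G"
  proof (rule subgroupI)
    show "W \<subseteq> carrier G" using g' by (auto simp: W_def)
    show "W \<noteq> {}" by (auto simp: W_def)
  next
    fix a b assume "a \<in> W" "b \<in> W"
    then obtain m n where "a = (\<Otimes>i\<in>I. g i [^] (m i :: nat))" "b = (\<Otimes>i\<in>I. g i [^] (n i :: nat))"
      by (auto simp: W_def)
    then have "a \<otimes> b = (\<Otimes>i\<in>I. g i [^] (m i + n i))" using finprod_pow_add[OF g] by simp
    then show "a \<otimes> b \<in> W" unfolding W_def by (intro range_eqI[of _ _ "\<lambda>i. m i + n i"])
  next
    fix a assume "a \<in> W"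
    then obtain m where m: "a = (\<Otimes>i\<in>I. g i [^] (m i :: nat))" by (auto simp: W_def)
    define b where "b = (\<Otimes>i\<in>I. g i [^] (m i * (order G - 1)))"
    have ord: "order G > 0" using fin by (simp add: order_gt_0_iff_finite)
    have "b \<otimes> a = (\<Otimes>i\<in>I. g i [^] (m i * (order G - 1) + m i))"
      unfolding b_def m by (rule finprod_pow_add[OF g, symmetric])
    also have "\<dots> = (\<Otimes>i\<in>I. \<one>)"
    proof (intro finprod_cong' refl)
      fix i assume "i \<in> I"
      then have "g i \<in> carrier G" using g by auto
      moreover have "m i * (order G - 1) + m i = order G * m i"
        using ord by (cases "order G") auto
      ultimately show "g i [^] (m i * (order G - 1) + m i) = \<one>"
        by (simp add: nat_pow_pow[symmetric] pow_order_eq_1)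
    qed auto
    finally have "b \<otimes> a = \<one>" by simp
    then have "inv a = b" using g' unfolding m b_def by (intro inv_equality) auto
    then show "inv a \<in> W" 
      unfolding W_def b_def by (intro range_eqI[of _ _ "\<lambda>i. m i * (order G - 1)"])
  qed
  moreover have "g ` I \<subseteq> W"
  proof
    fix y assume "y \<in> g ` I"
    then obtain j where j: "j \<in> I" "y = g j" by blast
    have "(\<Otimes>i\<in>I. g i [^] (if i = j then 1 else 0 :: nat)) = (\<Otimes>i\<in>I. if j = i then g i else \<one>)"
      using g by (intro finprod_cong') (auto simp: Pi_def)
    also have "\<dots> = y" using j fin g by (simp add: finprod_singleton)
    finally have "y = (\<Otimes>i\<in>I. g i [^] (if i = j then 1 else 0 :: nat))" ..
    then show "y \<in> W" unfolding W_def by (intro range_eqI[of _ _ "\<lambda>i. if i = j then 1 else 0"])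
  qed
  ultimately have "x \<in> W" using x generate_subgroup_incl by blast
  then show thesis using that by (auto simp: W_def)
qed

text \<open>Finite families of elements \<open>g i\<close> of prime power exponent \<open>p i ^ a i\<close> at most \<open>m\<close>;
  \<open>a i = 0\<close> (hence \<open>g i = \<one>\<close>) is allowed, so that relations can be used up one factor \<open>p\<close> at
  a time.\<close>

definition primary_family :: "nat \<Rightarrow> 'i set \<Rightarrow> ('i \<Rightarrow> 'a) \<Rightarrow> ('i \<Rightarrow> nat) \<Rightarrow> ('i \<Rightarrow> nat) \<Rightarrow> bool" where
  "primary_family m I g p a \<longleftrightarrow> finite I \<and> generate G (g ` I) = carrier G \<and>
     (\<forall>i\<in>I. g i \<in> carrier G \<and> Factorial_Ring.prime (p i) \<and> p i ^ a i \<le> m \<and> g i [^] (p i ^ a i) = \<one>)"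

text \<open>Each generator \<open>h\<close> is split into its primary parts: dividing
  \<open>ord h\<close> by its exact power of \<open>p\<close> gives the exponent of the
  \<open>p\<close>-part. Primes up to \<open>m\<close> suffice, since they include all prime
  divisors of the orders.\<close>

lemma primary_family_exists:
  assumes fin: "finite (carrier G)" and A: "A \<subseteq> carrier G" "\<forall>h\<in>A. ord h \<le> m"
    and gen: "generate G A = carrier G"
  shows "\<exists>(I :: ('a \<times> nat) set) g p a. primary_family m I g p a"
proof -
  define I where "I = A \<times> {p. Factorial_Ring.prime p \<and> p \<le> m}"
  define g where "g = (\<lambda>(h, p). h [^] (ord h div p ^ multiplicity p (ord h)))"
  define a where "a = (\<lambda>(h, p). multiplicity p (ord h))"
  have pos: "ord h > 0" if "h \<in> A" for h using ord_ge_1[OF fin, of h] that A by auto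
  have "finite A" using A fin by (blast intro: finite_subset)
  then have "finite I" by (auto simp: I_def)
  have gI: "g ` I \<subseteq> carrier G" using A by (auto simp: g_def I_def)
  let ?K = "generate G (g ` I)"
  have K: "subgroup ?K G" by (rule generate_is_subgroup[OF gI])
  have "h \<in> ?K" if h: "h \<in> A" for h
  proof -
    have hc: "h \<in> carrier G" using h A by blast
    let ?P = "\<lambda>k :: nat. 0 < k \<and> h [^] k \<in> ?K"
    have ex: "?P (ord h)" using pos[OF h] hc K by (simp add: subgroup.one_closed)
    \<comment> \<open>All exponents carrying \<open>h\<close> into the subgroup are multiples of the
      least positive one, \<open>d\<close>. A prime \<open>p\<close> dividing \<open>d\<close> would
      divide \<open>ord h\<close> with its full power of \<open>p\<close> removed, so
      \<open>d = 1\<close>.\<close>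
    define d where "d = (LEAST k. ?P k)"
    have d: "?P d" unfolding d_def using ex by (rule LeastI)
    have dvd: "d dvd k" if "h [^] k \<in> ?K" for k
    proof -
      have "?P (gcd d k)" using subgroup_pow_gcd[OF K hc] d that by simp
      then have "d \<le> gcd d k" unfolding d_def by (rule Least_le)
      moreover have "gcd d k \<le> d" using d by (simp add: gcd_le1_nat)
      ultimately show ?thesis by (metis gcd_dvd2 le_antisym)
    qed
    have "d = 1"
    proof (rule ccontr)
      assume "d \<noteq> 1"
      then obtain p where p: "Factorial_Ring.prime p" "p dvd d" using prime_factor_nat by blast
      have "p dvd ord h" using p dvd[of "ord h"] hc K by (auto simp: subgroup.one_closed)
      then have "p \<le> m" using pos[OF h] h A(2) by (meson dvd_imp_le le_trans)
      then have "(h, p) \<in> I" using h p by (simp add: I_def)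
      then have "g (h, p) \<in> ?K" by (auto intro: generate.incl)
      then have "p dvd ord h div p ^ multiplicity p (ord h)"
        using dvd p by (auto simp: g_def intro: dvd_trans)
      then show False using multiplicity_decompose[of "ord h" p] pos[OF h] p(1)
        by (auto simp: prime_nat_iff)
    qed
    then show ?thesis using d hc by simp
  qed
  then have "generate G A \<subseteq> ?K" using K by (intro generate_subgroup_incl) auto
  then have "?K = carrier G" using gen generate_incl[OF gI] by auto
  moreover have "g i \<in> carrier G \<and> Factorial_Ring.prime (snd i) \<and> snd i ^ a i \<le> m \<and> g i [^] (snd i ^ a i) = \<one>"
    if i: "i \<in> I" for i
  proof -
    obtain h p where hp: "i = (h, p)" "h \<in> A" "Factorial_Ring.prime p" "h \<in> carrier G" using i A by (auto simp: I_def)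
    have "p ^ multiplicity p (ord h) \<le> ord h"
      using pos hp by (intro dvd_imp_le multiplicity_dvd) auto
    moreover have "ord h div p ^ multiplicity p (ord h) * p ^ multiplicity p (ord h) = ord h"
      by (simp add: multiplicity_dvd)
    ultimately show ?thesis
      using hp A(2) by (auto simp: g_def a_def nat_pow_pow intro: le_trans)
  qed
  ultimately have "primary_family m I g snd a" using \<open>finite I\<close> by (simp add: primary_family_def)
  then show ?thesis by blast
qed

text \<open>An exchange argument: in the \<open>q\<close>-part of the relation, the generator
  \<open>g i1\<close> whose exponent has least \<open>q\<close>-adic valuation \<open>b\<close> is
  replaced by an element \<open>y\<close> killed by \<open>q ^ b\<close>, where
  \<open>b < a i1\<close>. The new family still generates because \<open>y\<close> contains
  \<open>g i1\<close> with an exponent prime to \<open>q\<close>.\<close>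

lemma primary_family_shrink:
  fixes n :: "'i \<Rightarrow> nat"
  assumes fam: "primary_family m I g p a" and rel: "(\<Otimes>i\<in>I. g i [^] n i) = \<one>"
    and i0: "i0 \<in> I" "\<not> p i0 ^ a i0 dvd n i0"
  shows "\<exists>g' a'. primary_family m I g' p a' \<and> (\<Prod>i\<in>I. p i ^ a' i) < (\<Prod>i\<in>I. p i ^ a i)"
proof -
  have I: "finite I" and gen: "generate G (g ` I) = carrier G"
    and g: "\<And>i. i \<in> I \<Longrightarrow> g i \<in> carrier G" and pr: "\<And>i. i \<in> I \<Longrightarrow> Factorial_Ring.prime (p i)"
    and le: "\<And>i. i \<in> I \<Longrightarrow> p i ^ a i \<le> m" and pow: "\<And>i. i \<in> I \<Longrightarrow> g i [^] (p i ^ a i) = \<one>"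
    using fam by (auto simp: primary_family_def)
  have pow': "g i [^] k = \<one>" if "i \<in> I" "p i ^ a i dvd k" for i k
    using that pow[OF that(1)] g by (auto simp: nat_pow_pow[symmetric] elim!: dvdE)
  define q where "q = p i0"
  have q: "Factorial_Ring.prime q" using pr i0 by (simp add: q_def)
  define J where "J = {i \<in> I. p i = q \<and> \<not> p i ^ a i dvd n i}"
  have J: "J \<subseteq> I" "finite J" "i0 \<in> J" using I i0 by (auto simp: J_def q_def)
  \<comment> \<open>Raising the relation to the power \<open>N\<close> kills all factors at primes
    other than \<open>q\<close>, while \<open>N\<close> itself is prime to \<open>q\<close>.\<close>
  define N where "N = (\<Prod>i\<in>{i\<in>I. p i \<noteq> q}. p i ^ a i)"
  have N: "coprime q N" unfolding N_def using q pr
    by (intro prod_coprime_right) (auto intro!: primes_coprime)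
  have relJ: "(\<Otimes>i\<in>J. g i [^] (n i * N)) = \<one>"
  proof -
    have "(\<Otimes>i\<in>J. g i [^] (n i * N)) = (\<Otimes>i\<in>I. g i [^] (n i * N))"
    proof (rule finprod_mono_neutral_cong_left[OF I J(1)])
      fix i assume i: "i \<in> I - J"
      have "p i ^ a i dvd n i * N"
      proof (cases "p i = q")
        case False
        then show ?thesis unfolding N_def using I i by (intro dvd_mult dvd_prodI) auto
      qed (use i in \<open>auto simp: J_def\<close>)
      then show "g i [^] (n i * N) = \<one>" using i pow' by blast
    qed (use g in auto)
    also have "\<dots> = (\<Otimes>i\<in>I. (g i [^] n i) [^] N)"
      using g by (intro finprod_cong') (auto simp: nat_pow_pow)
    also have "\<dots> = (\<Otimes>i\<in>I. g i [^] n i) [^] N" using g by (intro finprod_nat_pow) auto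
    finally show ?thesis using rel by simp
  qed
  define v where "v i = multiplicity q (n i)" for i
  obtain i1 where i1: "i1 \<in> J" "\<And>i. i \<in> J \<Longrightarrow> v i1 \<le> v i"
    using ex_min_if_finite[of "v ` J"] J by (metis (no_types, lifting) arg_min_if_finite(1) arg_min_least empty_iff)
  define b where "b = v i1"
  have i1I: "i1 \<in> I" "p i1 = q" using i1 J by (auto simp: J_def)
  define r where "r i = n i div q ^ b" for i
  have r: "n i = r i * q ^ b" if "i \<in> J" for i
    using i1(2)[OF that] by (simp add: r_def b_def v_def multiplicity_dvd')
  have r1: "\<not> q dvd r i1" unfolding r_def b_def v_def
    using i1(1) q by (intro multiplicity_decompose) (auto simp: J_def intro!: Nat.gr0I)
  have ba: "b < a i1"
  proof (rule ccontr)
    assume "\<not> b < a i1"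
    then have "q ^ a i1 dvd n i1" unfolding b_def v_def by (intro multiplicity_dvd') auto
    then show False using i1(1) by (auto simp: J_def)
  qed
  \<comment> \<open>The common factor \<open>q ^ b\<close> is removed from the exponents of the
    \<open>q\<close>-part, so that \<open>y [^] (q ^ b)\<close> is the left-hand side of
    \<open>relJ\<close>.\<close>
  define y where "y = (\<Otimes>i\<in>J. g i [^] (r i * N))"
  have gJ: "(\<lambda>i. g i [^] (r i * N)) \<in> J \<rightarrow> carrier G" using g J by auto
  have yc: "y \<in> carrier G" unfolding y_def using gJ by (rule finprod_closed)
  have y: "y [^] (q ^ b) = \<one>"
  proof -
    have "y [^] (q ^ b) = (\<Otimes>i\<in>J. (g i [^] (r i * N)) [^] (q ^ b))"
      unfolding y_def using gJ by (rule finprod_nat_pow[symmetric])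
    also have "\<dots> = (\<Otimes>i\<in>J. g i [^] (n i * N))"
      using g J(1) by (intro finprod_cong') (auto simp: nat_pow_pow r mult_ac)
    finally show ?thesis using relJ by simp
  qed
  define g' where "g' = g(i1 := y)"
  define a' where "a' = a(i1 := b)"
  have g'I: "g' ` I \<subseteq> carrier G" using g yc by (auto simp: g'_def)
  let ?K = "generate G (g' ` I)"
  have K: "subgroup ?K G" by (rule generate_is_subgroup[OF g'I])
  have gK: "g i \<in> ?K" if "i \<in> I" "i \<noteq> i1" for i
  proof -
    have "g' i \<in> ?K" using that by (intro generate.incl) auto
    then show ?thesis using that by (simp add: g'_def)
  qed
  have yK: "y \<in> ?K"
  proof -
    have "g' i1 \<in> ?K" using i1I by (intro generate.incl) auto
    then show ?thesis by (simp add: g'_def)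
  qed
  have "g i1 \<in> ?K"
  proof -
    define z where "z = (\<Otimes>i\<in>J - {i1}. g i [^] (r i * N))"
    have zK: "z \<in> ?K" unfolding z_def
      using J gK by (intro finprod_in_subgroup[OF K]) (auto intro!: subgroup_nat_pow_closed[OF K])
    then have zc: "z \<in> carrier G" using K subgroup.subset by blast
    have "y = g i1 [^] (r i1 * N) \<otimes> z"
    proof -
      have "y = (\<Otimes>i\<in>insert i1 (J - {i1}). g i [^] (r i * N))"
        unfolding y_def using i1(1) by (simp add: insert_absorb)
      also have "\<dots> = g i1 [^] (r i1 * N) \<otimes> z" unfolding z_def
        using J gJ g i1I by (intro finprod_insert) auto
      finally show ?thesis .
    qed
    \<comment> \<open>Two coprime exponents, \<open>r i1 * N\<close> and \<open>q ^ a i1\<close>,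
      carry \<open>g i1\<close> into the new subgroup.\<close>
    then have "g i1 [^] (r i1 * N) = y \<otimes> inv z" using g i1I zc by (simp add: m_assoc)
    then have "g i1 [^] (r i1 * N) \<in> ?K" using yK zK K
      by (simp add: subgroup.m_closed subgroup.m_inv_closed)
    moreover have "g i1 [^] (q ^ a i1) \<in> ?K" using pow[OF i1I(1)] i1I K by (simp add: subgroup.one_closed)
    ultimately have "g i1 [^] gcd (r i1 * N) (q ^ a i1) \<in> ?K"
      using subgroup_pow_gcd[OF K] g i1I by blast
    moreover have "coprime (r i1 * N) (q ^ a i1)"
      using N r1 q by (simp add: coprime_commute prime_imp_coprime)
    ultimately show ?thesis using g i1I by simp
  qed
  then have "g ` I \<subseteq> ?K" using gK by blast
  then have "carrier G \<subseteq> ?K" using gen generate_subgroup_incl[OF _ K] by blast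
  then have "?K = carrier G" using generate_incl[OF g'I] by blast
  moreover have "g' i \<in> carrier G \<and> Factorial_Ring.prime (p i) \<and> p i ^ a' i \<le> m \<and> g' i [^] (p i ^ a' i) = \<one>"
    if i: "i \<in> I" for i
  proof (cases "i = i1")
    case True
    have "q ^ b \<le> q ^ a i1" using ba q by (intro power_increasing) (auto simp: prime_ge_Suc_0_nat)
    then have "q ^ b \<le> m" using le[OF i1I(1)] i1I by simp
    then show ?thesis using True yc y q i1I by (simp add: g'_def a'_def)
  next
    case False
    then show ?thesis using i g pr le pow by (simp add: g'_def a'_def)
  qed
  ultimately have "primary_family m I g' p a'" using I by (simp add: primary_family_def)
  moreover have "(\<Prod>i\<in>I. p i ^ a' i) < (\<Prod>i\<in>I. p i ^ a i)"
  proof -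
    have "0 < (\<Prod>i\<in>I - {i1}. p i ^ a i)" using pr by (intro prod_pos) (auto simp: prime_gt_0_nat)
    moreover have "(\<Prod>i\<in>I - {i1}. p i ^ a' i) = (\<Prod>i\<in>I - {i1}. p i ^ a i)"
      by (intro prod.cong) (auto simp: a'_def)
    moreover have "q ^ b < q ^ a i1" using ba q by (intro power_strict_increasing) (auto simp: prime_gt_Suc_0_nat)
    ultimately show ?thesis
      using i1I by (simp add: prod.remove[OF I, of i1] a'_def)
  qed
  ultimately show ?thesis by blast
qed

text \<open>In a generating family with the smallest possible product of the \<open>p i ^ a i\<close> every
  relation is trivial.\<close>

lemma primary_decomposition:
  assumes fin: "finite (carrier G)" and A: "A \<subseteq> carrier G" "\<forall>h\<in>A. ord h \<le> m"
    and gen: "generate G A = carrier G"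
  obtains I :: "('a \<times> nat) set" and g p a where "primary_family m I g p a"
    and "\<And>n i. (\<Otimes>i\<in>I. g i [^] (n i :: nat)) = \<one> \<Longrightarrow> i \<in> I \<Longrightarrow> p i ^ a i dvd n i"
proof -
  obtain I :: "('a \<times> nat) set" and g0 p a0 where 0: "primary_family m I g0 p a0"
    using primary_family_exists[OF assms] by blast
  define \<mu> where "\<mu> = (\<lambda>(g :: 'a \<times> nat \<Rightarrow> 'a, a). \<Prod>i\<in>I. p i ^ a i)"
  obtain ga where ga: "primary_family m I (fst ga) p (snd ga)"
    and min: "\<And>ga'. primary_family m I (fst ga') p (snd ga') \<Longrightarrow> \<mu> ga \<le> \<mu> ga'"
    using ex_has_least_nat[of "\<lambda>ga. primary_family m I (fst ga) p (snd ga)" "(g0, a0)" \<mu>] 0 by auto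
  show thesis
  proof (rule that[OF ga])
    fix n i assume rel: "(\<Otimes>i\<in>I. fst ga i [^] (n i :: nat)) = \<one>" "i \<in> I"
    show "p i ^ snd ga i dvd n i"
    proof (rule ccontr)
      assume "\<not> ?thesis"
      then obtain g' a' where "primary_family m I g' p a'"
        and "(\<Prod>i\<in>I. p i ^ a' i) < (\<Prod>i\<in>I. p i ^ snd ga i)"
        using primary_family_shrink[OF ga rel] by blast
      then show False using min[of "(g', a')"] by (simp add: \<mu>_def case_prod_beta)
    qed
  qed
qed

text \<open>Exponent vectors in the box parametrise the group: reducing exponents modulo
  \<open>p i ^ a i\<close> gives surjectivity, and the triviality of relations gives
  injectivity.\<close>

lemma primary_family_order:
  fixes I :: "'i set"
  assumes fin: "finite (carrier G)" and fam: "primary_family m I g p a"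
    and indep: "\<And>n i. (\<Otimes>i\<in>I. g i [^] (n i :: nat)) = \<one> \<Longrightarrow> i \<in> I \<Longrightarrow> p i ^ a i dvd n i"
  shows "order G = (\<Prod>i\<in>I. p i ^ a i)"
proof -
  have I: "finite I" and gen: "generate G (g ` I) = carrier G"
    and g: "g \<in> I \<rightarrow> carrier G" and pos: "\<And>i. i \<in> I \<Longrightarrow> 0 < p i ^ a i"
    and pow: "\<And>i. i \<in> I \<Longrightarrow> g i [^] (p i ^ a i) = \<one>"
    using fam by (auto simp: primary_family_def prime_gt_0_nat)
  let ?E = "\<Pi>\<^sub>E i\<in>I. {..<p i ^ a i}"
  define \<Phi> where "\<Phi> e = (\<Otimes>i\<in>I. g i [^] e i)" for e :: "'i \<Rightarrow> nat"
  have gi: "(\<lambda>i. g i [^] e i) \<in> I \<rightarrow> carrier G" for e :: "'i \<Rightarrow> nat" using g by auto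
  have "bij_betw \<Phi> ?E (carrier G)"
    unfolding bij_betw_def
  proof
    show "inj_on \<Phi> ?E"
    proof (rule inj_onI)
      fix e e' assume e: "e \<in> ?E" "e' \<in> ?E" "\<Phi> e = \<Phi> e'"
      have lt: "e i < p i ^ a i" "e' i < p i ^ a i" if "i \<in> I" for i using e that by auto
      \<comment> \<open>Adding \<open>?c\<close> replaces subtracting \<open>e'\<close> within
        natural exponents: \<open>e' i + ?c i\<close> is exactly \<open>p i ^ a i\<close> on
        \<open>I\<close>.\<close>
      let ?c = "\<lambda>i. p i ^ a i - e' i"
      have "(\<Otimes>i\<in>I. g i [^] (e i + ?c i)) = (\<Otimes>i\<in>I. g i [^] (e' i + ?c i))"
        using e(3) by (simp add: finprod_pow_add[OF g] \<Phi>_def)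
      also have "\<dots> = \<one>"
        using lt pow by (intro finprod_one_eqI) (simp add: less_imp_le)
      finally have dvd: "p i ^ a i dvd e i + ?c i" if "i \<in> I" for i using indep[of "\<lambda>i. e i + ?c i"] that by blast
      show "e = e'"
      proof (rule PiE_ext[OF e(1,2)])
        fix i assume i: "i \<in> I"
        then have "int (p i ^ a i) dvd int (e i + ?c i)" using dvd by (simp only: of_nat_dvd_iff)
        then have "int (p i ^ a i) dvd int (e i) - int (e' i)"
        proof -
          have "int (e i + ?c i) = int (e i) - int (e' i) + int (p i ^ a i)" using lt[OF i] by simp
          then show ?thesis using \<open>int (p i ^ a i) dvd int (e i + ?c i)\<close> by (metis dvd_add_triv_right_iff)
        qed
        then have "int (e i) mod int (p i ^ a i) = int (e' i) mod int (p i ^ a i)"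
          by (simp only: mod_eq_dvd_iff)
        then show "e i = e' i" using lt[OF i] by (simp only: mod_less flip: zmod_int)
      qed
    qed
    show "\<Phi> ` ?E = carrier G"
    proof
      show "\<Phi> ` ?E \<subseteq> carrier G" using gi by (auto simp: \<Phi>_def)
      show "carrier G \<subseteq> \<Phi> ` ?E"
      proof
        fix x assume "x \<in> carrier G"
        then obtain n where n: "x = (\<Otimes>i\<in>I. g i [^] (n i :: nat))"
          using generate_eq_finprod_pow[OF fin I g] gen by blast
        let ?e = "\<lambda>i\<in>I. n i mod p i ^ a i"
        have "x = \<Phi> ?e" unfolding n \<Phi>_def
        proof (rule finprod_cong'[OF refl gi])
          fix i assume i: "i \<in> I"
          then have "g i \<in> carrier G" using g by auto
          have "g i [^] n i = g i [^] (p i ^ a i * (n i div p i ^ a i) + n i mod p i ^ a i)" by simp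
          also have "\<dots> = (g i [^] (p i ^ a i)) [^] (n i div p i ^ a i) \<otimes> g i [^] (n i mod p i ^ a i)"
            using \<open>g i \<in> carrier G\<close> by (simp only: nat_pow_mult nat_pow_pow nat_pow_closed)
          also have "\<dots> = g i [^] (n i mod p i ^ a i)" using pow[OF i] \<open>g i \<in> carrier G\<close> by simp
          finally show "g i [^] n i = g i [^] ?e i" using i by simp
        qed
        moreover have "?e \<in> ?E" using pos by auto
        ultimately show "x \<in> \<Phi> ` ?E" by blast
      qed
    qed
  qed
  then have "card ?E = order G" unfolding order_def by (rule bij_betw_same_card)
  then show ?thesis using I by (simp add: card_PiE)
qed

end

section \<open>The bound for tricolored sum-free sets\<close>

lemma prod_dvd_if_pairwise_coprime:
  fixes f :: "'i \<Rightarrow> nat"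
  assumes "finite S" "\<And>x. x \<in> S \<Longrightarrow> f x dvd n"
    and "\<And>x y. x \<in> S \<Longrightarrow> y \<in> S \<Longrightarrow> x \<noteq> y \<Longrightarrow> coprime (f x) (f y)"
  shows "(\<Prod>x\<in>S. f x) dvd n"
  using assms
proof (induction S rule: finite_induct)
  case (insert x S)
  have "coprime (f x) (\<Prod>y\<in>S. f y)"
    using insert.hyps insert.prems(2) by (intro prod_coprime_right) auto
  then show ?case using insert by (simp add: divides_mult)
qed simp

text \<open>The factors are grouped by prime. A prime \<open>r\<close> has at most \<open>n\<close>
  nontrivial ones, each at most its largest power \<open>r ^ c r\<close>. These largest powers are
  at most \<open>m\<close> and pairwise coprime, so their product divides
  \<open>lcm_upto m\<close>.\<close>

lemma prod_prime_powers_le: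
  fixes p a :: "'i \<Rightarrow> nat"
  assumes I: "finite I" and p: "\<And>i. i \<in> I \<Longrightarrow> Factorial_Ring.prime (p i)"
    and le: "\<And>i. i \<in> I \<Longrightarrow> p i ^ a i \<le> m"
    and n: "\<And>r. card {i \<in> I. p i = r \<and> 0 < a i} \<le> n"
  shows "(\<Prod>i\<in>I. p i ^ a i) \<le> lcm_upto m ^ n"
proof -
  define c where "c r = Max (a ` {i \<in> I. p i = r})" for r
  have c: "a i \<le> c (p i)" if "i \<in> I" for i
    unfolding c_def using I that by (intro Max_ge) auto
  have c': "\<exists>i\<in>I. p i = r \<and> c r = a i" if "r \<in> p ` I" for r
  proof -
    have "c r \<in> a ` {i \<in> I. p i = r}" unfolding c_def using I that by (intro Max_in) auto
    then show ?thesis by auto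
  qed
  have "(\<Prod>i\<in>I. p i ^ a i) = (\<Prod>r\<in>p ` I. \<Prod>i | i \<in> I \<and> p i = r. p i ^ a i)"
    using I by (intro prod.group[symmetric]) auto
  also have "\<dots> \<le> (\<Prod>r\<in>p ` I. (r ^ c r) ^ n)"
  proof (intro prod_mono conjI)
    fix r assume r: "r \<in> p ` I"
    then have r1: "1 \<le> r" using p by (auto simp: prime_ge_Suc_0_nat)
    have "(\<Prod>i | i \<in> I \<and> p i = r. p i ^ a i) = (\<Prod>i | i \<in> I \<and> p i = r \<and> 0 < a i. r ^ a i)"
      using I by (intro prod.mono_neutral_cong_right) auto
    also have "\<dots> \<le> (\<Prod>i | i \<in> I \<and> p i = r \<and> 0 < a i. r ^ c r)"
      using c r1 by (intro prod_mono) (auto intro!: power_increasing)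
    also have "\<dots> = (r ^ c r) ^ card {i \<in> I. p i = r \<and> 0 < a i}" by simp
    also have "\<dots> \<le> (r ^ c r) ^ n" using r1 n by (intro power_increasing) auto
    finally show "(\<Prod>i | i \<in> I \<and> p i = r. p i ^ a i) \<le> (r ^ c r) ^ n" .
  qed auto
  also have "\<dots> = (\<Prod>r\<in>p ` I. r ^ c r) ^ n" by (simp add: prod_power_distrib)
  also have "\<dots> \<le> lcm_upto m ^ n"
  proof (rule power_mono[OF dvd_imp_le])
    have "r ^ c r dvd lcm_upto m" if r: "r \<in> p ` I" for r
      using c'[OF r] le p by (intro dvd_lcm_upto) (auto simp: prime_gt_0_nat)
    moreover have "coprime (r ^ c r) (r' ^ c r')" if "r \<in> p ` I" "r' \<in> p ` I" "r \<noteq> r'" for r r'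
      using that p by (auto intro!: primes_coprime)
    ultimately show "(\<Prod>r\<in>p ` I. r ^ c r) dvd lcm_upto m"
      using I by (intro prod_dvd_if_pairwise_coprime) auto
  qed (auto simp: lcm_upto_pos)
  finally show ?thesis .
qed

text \<open>\<open>3 / 4 * 2 powr (1 / 3)\<close> is the reciprocal of
  \<open>2 / 3 * 2 powr (2 / 3)\<close>, whose logarithm is \<open>2 * eps\<close>.\<close>

lemma ln_eps: "ln (3 / 4 * 2 powr (1 / 3) :: real) = - 2 * eps"
proof -
  have "ln (4 :: real) = 2 * ln 2" using ln_realpow[of 2 2] by simp
  then show ?thesis by (simp add: eps_def ln_mult ln_div ln_powr)
qed

text \<open>The cube of \<open>2 / 3 * 2 powr (2 / 3)\<close> is \<open>32 / 27\<close>, which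
  exceeds 1.\<close>

lemma eps_nonneg: "0 \<le> eps"
proof -
  have "3 * ln 3 \<le> (5 :: real) * ln 2"
    using ln_realpow[of 3 3] ln_realpow[of 2 5] ln_mono[of "27 :: real" 32] by simp
  then show ?thesis by (simp add: eps_def ln_mult ln_div ln_powr)
qed

text \<open>Exponent vectors turn the equation in \<open>H\<close> into congruences modulo the
  \<open>p i ^ a i\<close>. The elements of \<open>M\<close> serve as the index set of the tensor,
  whose entry at \<open>x\<close>, \<open>y\<close>, \<open>z\<close> tests the first coordinate of
  \<open>x\<close>, the second of \<open>y\<close> and the third of \<open>z\<close>.\<close>

lemma tricolored_sum_free_card_le:
  fixes H :: "('a, 'b) monoid_scheme"
  assumes H: "comm_group H" and fin: "finite (carrier H)"
    and fam: "comm_group.primary_family H m I g p a"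
    and indep: "\<And>n i. finprod H (\<lambda>i. g i [^]\<^bsub>H\<^esub> (n i :: nat)) I = \<one>\<^bsub>H\<^esub> \<Longrightarrow> i \<in> I
      \<Longrightarrow> p i ^ a i dvd n i"
    and M: "tricolored_sum_free H M" and r: "Factorial_Ring.prime r"
  shows "real (card M) \<le> 3 * (real (order H) * (3 / 4 * 2 powr (1 / 3)) ^ card {i \<in> I. p i = r \<and> 0 < a i})"
proof -
  interpret comm_group H by (rule H)
  have I: "finite I" and gen: "generate H (g ` I) = carrier H" and g: "g \<in> I \<rightarrow> carrier H"
    and pr: "\<And>i. i \<in> I \<Longrightarrow> Factorial_Ring.prime (p i)"
    and pow: "\<And>i. i \<in> I \<Longrightarrow> g i [^]\<^bsub>H\<^esub> (p i ^ a i) = \<one>\<^bsub>H\<^esub>"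
    using fam by (auto simp: primary_family_def)
  define q where "q i = p i ^ a i" for i
  define P where "P = {i \<in> I. p i = r \<and> 0 < a i}"
  have q1: "1 < q i" if "i \<in> P" for i
  proof -
    have "1 < r ^ a i" using that r by (intro one_less_power prime_gt_1_nat) (auto simp: P_def)
    then show ?thesis using that by (simp add: P_def q_def)
  qed
  let ?w = "\<lambda>n :: _ \<Rightarrow> nat. finprod H (\<lambda>i. g i [^]\<^bsub>H\<^esub> n i) I"
  have "\<forall>x\<in>carrier H. \<exists>n. x = ?w n"
    using generate_eq_finprod_pow[OF fin I g] gen by blast
  then obtain e where e: "\<And>x. x \<in> carrier H \<Longrightarrow> x = ?w (e x)" by metis
  have w1: "?w n = \<one>\<^bsub>H\<^esub> \<longleftrightarrow> (\<forall>i\<in>I. q i dvd n i)" for n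
  proof
    assume "\<forall>i\<in>I. q i dvd n i"
    moreover have "g i [^]\<^bsub>H\<^esub> (q i * k) = \<one>\<^bsub>H\<^esub>" if "i \<in> I" for i k
      using pow[OF that] funcset_mem[OF g that] by (simp add: q_def nat_pow_pow[symmetric])
    ultimately show "?w n = \<one>\<^bsub>H\<^esub>" by (intro finprod_one_eqI) (auto elim!: dvdE)
  qed (use indep in \<open>auto simp: q_def\<close>)
  have w3: "x \<otimes>\<^bsub>H\<^esub> y \<otimes>\<^bsub>H\<^esub> z = \<one>\<^bsub>H\<^esub> \<longleftrightarrow> (\<forall>i\<in>I. q i dvd e x i + e y i + e z i)"
    if "x \<in> carrier H" "y \<in> carrier H" "z \<in> carrier H" for x y z
  proof -
    have "x \<otimes>\<^bsub>H\<^esub> y \<otimes>\<^bsub>H\<^esub> z = ?w (e x) \<otimes>\<^bsub>H\<^esub> ?w (e y) \<otimes>\<^bsub>H\<^esub> ?w (e z)"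
      using e that by simp
    also have "\<dots> = ?w (\<lambda>i. e x i + e y i + e z i)" by (simp only: finprod_pow_add[OF g])
    finally show ?thesis by (simp only: w1)
  qed
  obtain S T U where STU: "S \<subseteq> carrier H" "T \<subseteq> carrier H" "U \<subseteq> carrier H"
    and pm: "perfect_matching3 S T U M"
    and M1: "\<forall>(s, t, u) \<in> M. s \<otimes>\<^bsub>H\<^esub> t \<otimes>\<^bsub>H\<^esub> u = \<one>\<^bsub>H\<^esub>"
    and M2: "\<forall>(s, t, u) \<in> (S \<times> T \<times> U) - M. s \<otimes>\<^bsub>H\<^esub> t \<otimes>\<^bsub>H\<^esub> u \<noteq> \<one>\<^bsub>H\<^esub>"
    using M unfolding tricolored_sum_free_def by (elim exE conjE)
  have sub: "M \<subseteq> S \<times> T \<times> U"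
    and inj: "inj_on (\<lambda>(s, t, u). s) M" "inj_on (\<lambda>(s, t, u). t) M" "inj_on (\<lambda>(s, t, u). u) M"
    using pm by (simp_all add: perfect_matching3_def bij_betw_def)
  have "finite M" using STU sub fin by (meson finite_SigmaI finite_subset)
  have "card M \<le> 3 * card (low_weight q I P)"
  proof (rule card_le_low_weight[where s = "\<lambda>\<mu>. e (fst \<mu>)" and t = "\<lambda>\<mu>. e (fst (snd \<mu>))"
        and u = "\<lambda>\<mu>. e (snd (snd \<mu>))", OF \<open>finite M\<close> I _ r])
    fix x y z assume xyz: "x \<in> M" "y \<in> M" "z \<in> M"
    obtain s t u where x: "x = (s, t, u)" by (cases x)
    obtain s' t' u' where y: "y = (s', t', u')" by (cases y)
    obtain s'' t'' u'' where z: "z = (s'', t'', u'')" by (cases z)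
    have mem: "s \<in> S" "t' \<in> T" "u'' \<in> U" using xyz sub x y z by auto
    then have "(\<forall>i\<in>I. q i dvd e s i + e t' i + e u'' i) \<longleftrightarrow> s \<otimes>\<^bsub>H\<^esub> t' \<otimes>\<^bsub>H\<^esub> u'' = \<one>\<^bsub>H\<^esub>"
      using w3[of s t' u''] STU by blast
    also have "\<dots> \<longleftrightarrow> (s, t', u'') \<in> M" using mem M1 M2 by blast
    also have "\<dots> \<longleftrightarrow> x = y \<and> y = z"
    proof
      assume *: "(s, t', u'') \<in> M"
      \<comment> \<open>An element of \<open>M\<close> is determined by any one coordinate, and this
        triple shares one with each of \<open>x\<close>, \<open>y\<close> and
        \<open>z\<close>.\<close>
      have "(s, t', u'') = x" using inj_onD[OF inj(1) _ * xyz(1)] x by simp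
      moreover have "(s, t', u'') = y" using inj_onD[OF inj(2) _ * xyz(2)] y by simp
      moreover have "(s, t', u'') = z" using inj_onD[OF inj(3) _ * xyz(3)] z by simp
      ultimately show "x = y \<and> y = z" by simp
    qed (use xyz x y z in auto)
    finally show "(\<forall>i\<in>I. q i dvd e (fst x) i + e (fst (snd y)) i + e (snd (snd z)) i) \<longleftrightarrow> x = y \<and> y = z"
      by (simp add: x y z)
  next
    fix i assume "i \<in> P"
    then show "1 < q i \<and> (\<exists>a. q i = r ^ a)" using q1 by (auto simp: P_def q_def)
  qed (use pr in \<open>auto simp: P_def q_def prime_gt_0_nat\<close>)
  then have "real (card M) \<le> 3 * real (card (low_weight q I P))" by (simp flip: of_nat_le_iff)
  also have "real (card (low_weight q I P)) \<le> (\<Prod>i\<in>I. real (q i)) * (3 / 4 * 2 powr (1 / 3)) ^ card P"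
    using q1 by (intro card_low_weight_le I) (auto simp: P_def)
  also have "(\<Prod>i\<in>I. real (q i)) = real (order H)"
  proof -
    have "order H = (\<Prod>i\<in>I. p i ^ a i)" using indep by (rule primary_family_order[OF fin fam])
    then show ?thesis by (simp add: q_def)
  qed
  finally show ?thesis by (simp add: P_def)
qed

theorem theoremA:
  fixes H :: "('a, 'b) monoid_scheme"
    and A :: "'a set"
    and m :: nat
    and M :: "('a \<times> 'a \<times> 'a) set"
  assumes "comm_group H"
    and "finite (carrier H)"
    and "m > 0"
    and "A \<subseteq> carrier H"
    and "\<forall>a\<in>A. group.ord H a \<le> m"
    and "generate H A = carrier H"
    and "tricolored_sum_free H M"
  shows "real (card M) \<le> 3 * real (order H) powr (1 - eps / real m)"
proof -
  interpret comm_group H by fact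
  obtain I :: "('a \<times> nat) set" and g p a where fam: "primary_family m I g p a"
    and indep: "\<And>n i. finprod H (\<lambda>i. g i [^]\<^bsub>H\<^esub> (n i :: nat)) I = \<one>\<^bsub>H\<^esub> \<Longrightarrow> i \<in> I
      \<Longrightarrow> p i ^ a i dvd n i"
    using primary_decomposition[OF assms(2,4,5,6)] by blast
  have I: "finite I" and pr: "\<And>i. i \<in> I \<Longrightarrow> Factorial_Ring.prime (p i)"
    and le: "\<And>i. i \<in> I \<Longrightarrow> p i ^ a i \<le> m"
    using fam by (auto simp: primary_family_def)
  define d where "d r = card {i \<in> I. p i = r \<and> 0 < a i}" for r
  \<comment> \<open>Inserting 2 keeps the set nonempty when \<open>I\<close> is empty, and the
    chosen \<open>r\<close> is still prime.\<close>
  let ?R = "insert 2 (p ` I)"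
  have R: "finite (d ` ?R)" using I by simp
  have "Max (d ` ?R) \<in> d ` ?R" using R by (rule Max_in) simp
  then obtain r where r: "r \<in> ?R" "Max (d ` ?R) = d r" by (rule imageE)
  have dr: "d r' \<le> d r" for r'
  proof (cases "r' \<in> p ` I")
    case False
    then have "{i \<in> I. p i = r' \<and> 0 < a i} = {}" by auto
    then show ?thesis unfolding d_def by (simp only: card.empty zero_le)
  next
    case True
    then have "d r' \<in> d ` ?R" by blast
    then show ?thesis using Max_ge[OF R] r(2) by metis
  qed
  have prime: "Factorial_Ring.prime r" using r(1) pr by auto
  define h where "h = real (order H)"
  have h: "1 \<le> h" using assms(2) order_gt_0_iff_finite by (simp add: h_def)
  have "order H \<le> (4 ^ m) ^ d r"
  proof -
    have "order H = (\<Prod>i\<in>I. p i ^ a i)" 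
      using indep by (rule primary_family_order[OF assms(2) fam])
    also have "\<dots> \<le> lcm_upto m ^ d r"
      using dr by (intro prod_prime_powers_le I pr le) (auto simp: d_def)
    also have "\<dots> \<le> (4 ^ m) ^ d r" by (intro power_mono lcm_upto_le) simp
    finally show ?thesis .
  qed
  then have "h \<le> 4 ^ (m * d r)" unfolding h_def power_mult by (metis of_nat_le_iff of_nat_numeral of_nat_power)
  then have "ln h \<le> ln (4 ^ (m * d r))" using h by (intro ln_mono) auto
  also have "\<dots> = real (m * d r) * (2 * ln 2)"
    using ln_realpow[of 2 2] by (simp add: ln_realpow)
  \<comment> \<open>The bound \<open>ln 4 < 2\<close> lets the exponent \<open>2 * eps * d r\<close>
    dominate \<open>eps / m * ln h\<close>.\<close>
  also have "\<dots> \<le> real (m * d r) * 2" using ln_2_less_1 by (intro mult_left_mono) auto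
  finally have lnh: "ln h \<le> 2 * real m * real (d r)" by simp
  have "(3 / 4 * 2 powr (1 / 3) :: real) ^ d r = exp (real (d r) * ln (3 / 4 * 2 powr (1 / 3)))"
    by (simp add: exp_of_nat_mult)
  also have "\<dots> \<le> exp (- (eps / real m) * ln h)"
  proof -
    have "eps / real m * ln h \<le> eps / real m * (2 * real m * real (d r))"
      using lnh eps_nonneg by (intro mult_left_mono) auto
    then show ?thesis unfolding ln_eps using assms(3) by (simp add: mult_ac)
  qed
  also have "\<dots> = h powr - (eps / real m)" using h by (simp add: powr_def)
  finally have J: "(3 / 4 * 2 powr (1 / 3) :: real) ^ d r \<le> h powr - (eps / real m)" .
  have "real (card M) \<le> 3 * (h * (3 / 4 * 2 powr (1 / 3)) ^ d r)"
    unfolding h_def d_def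
    by (rule tricolored_sum_free_card_le[OF assms(1,2) fam _ assms(7) prime]) (rule indep)
  also have "\<dots> \<le> 3 * (h * h powr - (eps / real m))"
    using J h by (intro mult_left_mono) auto
  also have "\<dots> = 3 * h powr (1 - eps / real m)"
    using h by (simp add: powr_diff powr_minus divide_inverse)
  finally show ?thesis by (simp add: h_def)
qed

end
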